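(* Suppose that $\kappa$ is a non-Galvin cardinal. Then $\kappa$ carries a $\kappa$-complete ultrafilter $U$ such that $\neg\mathrm{Gal}(U,\kappa,\kappa^+)$. In particular, if in addition $2^\kappa=\kappa^+$, then $U$ is a non-Galvin ultrafilter.
   Context: Non-Galvin cardinal: $\kappa$ is a non-Galvin cardinal if there are elementary embeddings $j:V\to M$, $i:V\to N$, $k:N\to M$ (with $M,N$ transitive inner models) such that: (1) $k\circ i=j$; (2) the critical point of $j$ is $\kappa$ and the critical point of $k$ is $i(\kappa)$; (3) ${}^\kappa N\subseteq N$ and ${}^\kappa M\subseteq M$; (4) there is $A\in M$ such that $\{i(\alpha)\mid\alpha<\kappa^+\}\subseteq A$ and $M\models|A|<i(\kappa)$. For a uniform ultrafilter $U$ over $\kappa$ and cardinals $\mu\le\lambda$, $\mathrm{Gal}(U,\mu,\lambda)$ is the statement that for every sequence $\langle A_i\rangle_{i<\lambda}$ of members of $U$ there is $I\subseteq\lambda$ with $|I|=\mu$ and $\bigcap_{i\in I}A_i\in U$. $U$ is non-Galvin if $\mathrm{Gal}(U,\kappa,2^\kappa)$ fails. $\kappa$-complete ultrafilters over $\kappa$ are understood to be nonprincipal. *)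

theory Defs
  imports Main
begin

text \<open>
  The set-theoretic universe \<open>V\<close> is a type with a membership relation satisfying ZFC.  The
  classes over \<open>V\<close> are the HOL predicates, sets and functions on that type; accordingly
  Separation and Replacement are stated for all HOL predicates and functions, so that they may
  be applied to formulas mentioning inner models and elementary embeddings.
\<close>

class zfc_universe =
  fixes mem :: "'a \<Rightarrow> 'a \<Rightarrow> bool"  (infix "\<^bold>\<in>" 50)
  assumes extensionality: "(\<And>x. x \<^bold>\<in> a \<longleftrightarrow> x \<^bold>\<in> b) \<Longrightarrow> a = b"
    and foundation: "x \<^bold>\<in> a \<Longrightarrow> \<exists>y. y \<^bold>\<in> a \<and> (\<forall>z. z \<^bold>\<in> y \<longrightarrow> \<not> z \<^bold>\<in> a)"
    and pairing: "\<exists>c. \<forall>x. x \<^bold>\<in> c \<longleftrightarrow> x = a \<or> x = b"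
    and union: "\<exists>b. \<forall>x. x \<^bold>\<in> b \<longleftrightarrow> (\<exists>y. y \<^bold>\<in> a \<and> x \<^bold>\<in> y)"
    and power_set: "\<exists>b. \<forall>x. x \<^bold>\<in> b \<longleftrightarrow> (\<forall>y. y \<^bold>\<in> x \<longrightarrow> y \<^bold>\<in> a)"
    and infinity: "\<exists>a. (\<exists>z. z \<^bold>\<in> a \<and> (\<forall>y. \<not> y \<^bold>\<in> z)) \<and>
          (\<forall>x. x \<^bold>\<in> a \<longrightarrow> (\<exists>s. s \<^bold>\<in> a \<and> (\<forall>y. y \<^bold>\<in> s \<longleftrightarrow> y \<^bold>\<in> x \<or> y = x)))"
    and separation: "\<exists>b. \<forall>x. x \<^bold>\<in> b \<longleftrightarrow> x \<^bold>\<in> a \<and> P x"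
    and replacement: "\<exists>b. \<forall>y. y \<^bold>\<in> b \<longleftrightarrow> (\<exists>x. x \<^bold>\<in> a \<and> y = F x)"
    and choice: "(\<forall>x. x \<^bold>\<in> a \<longrightarrow> (\<exists>z. z \<^bold>\<in> x)) \<Longrightarrow>
          (\<forall>x y. x \<^bold>\<in> a \<longrightarrow> y \<^bold>\<in> a \<longrightarrow> x \<noteq> y \<longrightarrow> \<not> (\<exists>z. z \<^bold>\<in> x \<and> z \<^bold>\<in> y)) \<Longrightarrow>
          \<exists>c. \<forall>x. x \<^bold>\<in> a \<longrightarrow> (\<exists>!z. z \<^bold>\<in> x \<and> z \<^bold>\<in> c)"

definition elts :: "'a::zfc_universe \<Rightarrow> 'a set" where
  "elts a = {x. x \<^bold>\<in> a}"

text \<open>The element of \<open>V\<close> with extension \<open>X\<close>; only meaningful if \<open>X\<close> is not a proper class.\<close>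

definition vset :: "'a::zfc_universe set \<Rightarrow> 'a" where
  "vset X = (THE a. elts a = X)"

definition opair :: "'a::zfc_universe \<Rightarrow> 'a \<Rightarrow> 'a" where
  "opair x y = vset {vset {x}, vset {x, y}}"

definition is_function :: "'a::zfc_universe \<Rightarrow> 'a \<Rightarrow> 'a set \<Rightarrow> bool" where
  "is_function f a B \<longleftrightarrow>
     (\<forall>p \<in> elts f. \<exists>x \<in> elts a. \<exists>y \<in> B. p = opair x y) \<and>
     (\<forall>x \<in> elts a. \<exists>!y. opair x y \<in> elts f)"

definition is_bijection :: "'a::zfc_universe \<Rightarrow> 'a \<Rightarrow> 'a \<Rightarrow> bool" where
  "is_bijection f a b \<longleftrightarrow>
     is_function f a (elts b) \<and> (\<forall>y \<in> elts b. \<exists>!x. opair x y \<in> elts f)"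

definition vtransitive :: "'a::zfc_universe \<Rightarrow> bool" where
  "vtransitive a \<longleftrightarrow> (\<forall>x \<in> elts a. elts x \<subseteq> elts a)"

definition Ord :: "'a::zfc_universe \<Rightarrow> bool" where
  "Ord a \<longleftrightarrow> vtransitive a \<and> (\<forall>x \<in> elts a. vtransitive x)"

text \<open>
  \<open>card_in M a\<close> is \<open>|a|\<close> as computed in the transitive class \<open>M\<close>: the least ordinal to which
  some bijection lying in \<open>M\<close> maps \<open>a\<close>.  Being an ordinal and being a bijection are absolute for
  transitive models of ZFC, so only the existence of the bijection has to be relativised.
\<close>

definition card_in :: "'a::zfc_universe set \<Rightarrow> 'a \<Rightarrow> 'a" where
  "card_in M a = (THE d. Ord d \<and> (\<exists>f \<in> M. is_bijection f a d) \<and>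
     (\<forall>b \<in> elts d. \<not> (\<exists>f \<in> M. is_bijection f a b)))"

abbreviation vcard :: "'a::zfc_universe \<Rightarrow> 'a" where
  "vcard \<equiv> card_in UNIV"

definition Card :: "'a::zfc_universe \<Rightarrow> bool" where
  "Card k \<longleftrightarrow> Ord k \<and> vcard k = k"

definition card_succ :: "'a::zfc_universe \<Rightarrow> 'a" where
  "card_succ k = (THE l. Card l \<and> k \<^bold>\<in> l \<and> (\<forall>m \<in> elts l. \<not> (Card m \<and> k \<^bold>\<in> m)))"

definition two_power :: "'a::zfc_universe \<Rightarrow> 'a" where
  "two_power k = vcard (vset {x. elts x \<subseteq> elts k})"


text \<open>First-order formulas of the language of set theory, with de Bruijn indices.\<close>

datatype fm = Mem nat nat | Eq nat nat | Neg fm | Conj fm fm | All fm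

primrec sat :: "'a::zfc_universe set \<Rightarrow> (nat \<Rightarrow> 'a) \<Rightarrow> fm \<Rightarrow> bool" where
  "sat M e (Mem m n) \<longleftrightarrow> e m \<^bold>\<in> e n"
| "sat M e (Eq m n) \<longleftrightarrow> e m = e n"
| "sat M e (Neg p) \<longleftrightarrow> \<not> sat M e p"
| "sat M e (Conj p q) \<longleftrightarrow> sat M e p \<and> sat M e q"
| "sat M e (All p) \<longleftrightarrow> (\<forall>x \<in> M. sat M (case_nat x e) p)"

definition models_zfc :: "'a::zfc_universe set \<Rightarrow> bool" where
  "models_zfc M \<longleftrightarrow>
     (\<forall>a\<in>M. \<forall>b\<in>M. (\<forall>x\<in>M. x \<^bold>\<in> a \<longleftrightarrow> x \<^bold>\<in> b) \<longrightarrow> a = b) \<and>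
     (\<forall>a\<in>M. (\<exists>x\<in>M. x \<^bold>\<in> a) \<longrightarrow> (\<exists>y\<in>M. y \<^bold>\<in> a \<and> (\<forall>z\<in>M. z \<^bold>\<in> y \<longrightarrow> \<not> z \<^bold>\<in> a))) \<and>
     (\<forall>a\<in>M. \<forall>b\<in>M. \<exists>c\<in>M. \<forall>x\<in>M. x \<^bold>\<in> c \<longleftrightarrow> x = a \<or> x = b) \<and>
     (\<forall>a\<in>M. \<exists>b\<in>M. \<forall>x\<in>M. x \<^bold>\<in> b \<longleftrightarrow> (\<exists>y\<in>M. y \<^bold>\<in> a \<and> x \<^bold>\<in> y)) \<and>
     (\<forall>a\<in>M. \<exists>b\<in>M. \<forall>x\<in>M. x \<^bold>\<in> b \<longleftrightarrow> (\<forall>y\<in>M. y \<^bold>\<in> x \<longrightarrow> y \<^bold>\<in> a)) \<and>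
     (\<exists>a\<in>M. (\<exists>z\<in>M. z \<^bold>\<in> a \<and> (\<forall>y\<in>M. \<not> y \<^bold>\<in> z)) \<and>
        (\<forall>x\<in>M. x \<^bold>\<in> a \<longrightarrow> (\<exists>s\<in>M. s \<^bold>\<in> a \<and> (\<forall>y\<in>M. y \<^bold>\<in> s \<longleftrightarrow> y \<^bold>\<in> x \<or> y = x)))) \<and>
     (\<forall>p e. range e \<subseteq> M \<longrightarrow>
        (\<forall>a\<in>M. \<exists>b\<in>M. \<forall>x\<in>M. x \<^bold>\<in> b \<longleftrightarrow> x \<^bold>\<in> a \<and> sat M (case_nat x e) p)) \<and>
     (\<forall>p e. range e \<subseteq> M \<longrightarrow>
        (\<forall>a\<in>M. (\<forall>x\<in>M. x \<^bold>\<in> a \<longrightarrow> (\<forall>y\<in>M. \<forall>z\<in>M.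
              sat M (case_nat x (case_nat y e)) p \<longrightarrow>
              sat M (case_nat x (case_nat z e)) p \<longrightarrow> y = z)) \<longrightarrow>
           (\<exists>b\<in>M. \<forall>y\<in>M. y \<^bold>\<in> b \<longleftrightarrow>
              (\<exists>x\<in>M. x \<^bold>\<in> a \<and> sat M (case_nat x (case_nat y e)) p)))) \<and>
     (\<forall>a\<in>M. (\<forall>x\<in>M. x \<^bold>\<in> a \<longrightarrow> (\<exists>z\<in>M. z \<^bold>\<in> x)) \<longrightarrow>
        (\<forall>x\<in>M. \<forall>y\<in>M. x \<^bold>\<in> a \<longrightarrow> y \<^bold>\<in> a \<longrightarrow> x \<noteq> y \<longrightarrow> \<not> (\<exists>z\<in>M. z \<^bold>\<in> x \<and> z \<^bold>\<in> y)) \<longrightarrow>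
        (\<exists>c\<in>M. \<forall>x\<in>M. x \<^bold>\<in> a \<longrightarrow> (\<exists>!z. z \<in> M \<and> z \<^bold>\<in> x \<and> z \<^bold>\<in> c)))"

definition inner_model :: "'a::zfc_universe set \<Rightarrow> bool" where
  "inner_model M \<longleftrightarrow> (\<forall>x \<in> M. elts x \<subseteq> M) \<and> {a. Ord a} \<subseteq> M \<and> models_zfc M"

definition elementary_embedding ::
    "('a::zfc_universe \<Rightarrow> 'a) \<Rightarrow> 'a set \<Rightarrow> 'a set \<Rightarrow> bool" where
  "elementary_embedding j M N \<longleftrightarrow> j ` M \<subseteq> N \<and>
     (\<forall>p e. range e \<subseteq> M \<longrightarrow> (sat M e p \<longleftrightarrow> sat N (j \<circ> e) p))"

definition critical_point :: "('a::zfc_universe \<Rightarrow> 'a) \<Rightarrow> 'a \<Rightarrow> bool" where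
  "critical_point j c \<longleftrightarrow> Ord c \<and> j c \<noteq> c \<and> (\<forall>a \<in> elts c. j a = a)"

definition closed_under_seqs :: "'a::zfc_universe \<Rightarrow> 'a set \<Rightarrow> bool" where
  "closed_under_seqs k M \<longleftrightarrow> (\<forall>f. is_function f k M \<longrightarrow> f \<in> M)"

definition non_Galvin_cardinal :: "'a::zfc_universe \<Rightarrow> bool" where
  "non_Galvin_cardinal k \<longleftrightarrow> (\<exists>M N j i h.
     inner_model M \<and> inner_model N \<and>
     elementary_embedding j UNIV M \<and> elementary_embedding i UNIV N \<and>
     elementary_embedding h N M \<and>
     h \<circ> i = j \<and>
     critical_point j k \<and> critical_point h (i k) \<and>
     closed_under_seqs k N \<and> closed_under_seqs k M \<and>
     (\<exists>A \<in> M. i ` elts (card_succ k) \<subseteq> elts A \<and> card_in M A \<^bold>\<in> i k))"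


definition inter_over :: "'a::zfc_universe \<Rightarrow> 'a set \<Rightarrow> 'a" where
  "inter_over k F = vset {x \<in> elts k. \<forall>X \<in> F. x \<in> elts X}"

definition ultrafilter_over :: "'a::zfc_universe \<Rightarrow> 'a \<Rightarrow> bool" where
  "ultrafilter_over k U \<longleftrightarrow>
     (\<forall>X \<in> elts U. elts X \<subseteq> elts k) \<and>
     k \<in> elts U \<and> vset {} \<notin> elts U \<and>
     (\<forall>X \<in> elts U. \<forall>Y. elts X \<subseteq> elts Y \<longrightarrow> elts Y \<subseteq> elts k \<longrightarrow> Y \<in> elts U) \<and>
     (\<forall>X \<in> elts U. \<forall>Y \<in> elts U. vset (elts X \<inter> elts Y) \<in> elts U) \<and>
     (\<forall>X. elts X \<subseteq> elts k \<longrightarrow> X \<in> elts U \<or> vset (elts k - elts X) \<in> elts U)"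

text \<open>
  \<open>k\<close>-complete ultrafilters over \<open>k\<close> are nonprincipal by convention.  For an infinite cardinal
  \<open>k\<close> this makes them uniform, so that \<open>Gal\<close> below applies to them.
\<close>

definition complete_ultrafilter_over :: "'a::zfc_universe \<Rightarrow> 'a \<Rightarrow> bool" where
  "complete_ultrafilter_over k U \<longleftrightarrow> ultrafilter_over k U \<and>
     (\<forall>a \<in> elts k. vset {a} \<notin> elts U) \<and>
     (\<forall>F. elts F \<subseteq> elts U \<longrightarrow> vcard F \<^bold>\<in> k \<longrightarrow> inter_over k (elts F) \<in> elts U)"

text \<open>
  The first argument is the underlying cardinal \<open>k\<close> of \<open>U\<close>.  By Replacement, a HOL function
  restricted to the elements of \<open>l\<close> is the same thing as an \<open>l\<close>-sequence in \<open>V\<close>.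
\<close>

definition Gal :: "'a::zfc_universe \<Rightarrow> 'a \<Rightarrow> 'a \<Rightarrow> 'a \<Rightarrow> bool" where
  "Gal k U m l \<longleftrightarrow> (\<forall>A :: 'a \<Rightarrow> 'a. (\<forall>i \<in> elts l. A i \<in> elts U) \<longrightarrow>
     (\<exists>I. elts I \<subseteq> elts l \<and> vcard I = m \<and> inter_over k (A ` elts I) \<in> elts U))"

definition non_Galvin_ultrafilter :: "'a::zfc_universe \<Rightarrow> 'a \<Rightarrow> bool" where
  "non_Galvin_ultrafilter k U \<longleftrightarrow> \<not> Gal k U k (two_power k)"

end

theory Submission
  imports Defs
begin

text \<open>
  Let \<open>g(\<alpha>, \<xi>, \<beta>) = otp {\<beta>' < \<beta>. e\<^sub>\<alpha>(\<beta>') < \<xi>}\<close> for injections \<open>e\<^sub>\<alpha>\<close> of \<open>\<alpha> < \<kappa>\<^sup>+\<close> into \<open>\<kappa>\<close>.  Since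
  \<open>i \<kappa>\<close> is the critical point of \<open>h\<close>, the image of \<open>\<gamma> < i(\<kappa>\<^sup>+)\<close> under \<open>h\<close> is the set of those
  ordinals below \<open>h \<gamma>\<close> to which \<open>j(e)\<close> at \<open>h \<gamma>\<close> assigns a value below \<open>i \<kappa>\<close>; hence
  \<open>j(g)(h \<gamma>, i \<kappa>, h \<gamma>) = \<gamma>\<close>.  In particular \<open>i(\<kappa>\<^sup>+)\<close> is bounded below \<open>j \<kappa>\<close>, so a bounded part of the
  covering set \<open>A\<close>, paired with \<open>i \<kappa>\<close>, is coded by an ordinal \<open>s < j \<kappa>\<close>.  Let \<open>U\<close> be the ultrafilter
  derived from \<open>j\<close> and \<open>s\<close>, and for \<open>\<alpha> < \<kappa>\<^sup>+\<close> let \<open>A\<^sub>\<alpha>\<close> be the set of codes of pairs \<open>(\<xi>, a)\<close> with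
  \<open>g(\<alpha>, \<xi>, \<alpha>) \<in> a\<close>.  Then \<open>A\<^sub>\<alpha> \<in> U\<close> because \<open>i \<alpha> \<in> A\<close>.  If the sets indexed by \<open>I\<close> with \<open>|I| = \<kappa>\<close> had
  intersection in \<open>U\<close>, then \<open>i(I) \<subseteq> A\<close>, so in \<open>M\<close> there would be an injection of \<open>i \<kappa>\<close> into a
  smaller ordinal, although \<open>i \<kappa>\<close> is a limit of \<open>N\<close>-cardinals that are fixed by \<open>h\<close>.
\<close>

section \<open>Sets and ordinals\<close>

text \<open>Marks the HOL sets on which \<open>vset\<close> is meaningful; elsewhere its definite
  description is unspecified, so computing with \<open>vset\<close> usually starts from a smallness
  proof.\<close>

definition small :: "'a::zfc_universe set \<Rightarrow> bool" where
  "small X \<longleftrightarrow> (\<exists>a. elts a = X)"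

lemma mem_iff: "x \<^bold>\<in> a \<longleftrightarrow> x \<in> elts a"
  by (simp add: elts_def)

lemma elts_inject: "elts a = elts b \<longleftrightarrow> a = b"
  using extensionality[of a b] unfolding mem_iff by blast

lemma elts_eqI: "(\<And>x. x \<in> elts a \<longleftrightarrow> x \<in> elts b) \<Longrightarrow> a = b"
  by (metis elts_inject subsetI subset_antisym)

lemma elts_vset [simp]: "small X \<Longrightarrow> elts (vset X) = X"
  unfolding vset_def small_def by (metis (mono_tags, lifting) elts_inject theI)

lemma vset_elts [simp]: "vset (elts a) = a"
  by (metis elts_inject elts_vset small_def)

lemma small_elts [simp]: "small (elts a)"
  unfolding small_def by blast

lemma small_subset:
  assumes "small X" "Y \<subseteq> X"
  shows "small Y"
proof -
  obtain a where a: "elts a = X"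
    using assms unfolding small_def by blast
  obtain b where "\<forall>x. x \<in> elts b \<longleftrightarrow> x \<in> elts a \<and> x \<in> Y"
    using separation[of a "\<lambda>x. x \<in> Y"] unfolding mem_iff by blast
  then have "elts b = Y"
    using a assms by blast
  then show ?thesis
    unfolding small_def by blast
qed

lemma small_image [simp]:
  fixes f :: "'a::zfc_universe \<Rightarrow> 'a"
  assumes "small X"
  shows "small (f ` X)"
proof -
  obtain a where a: "elts a = X"
    using assms unfolding small_def by blast
  obtain b where "\<forall>y. y \<in> elts b \<longleftrightarrow> (\<exists>x. x \<in> elts a \<and> y = f x)"
    using replacement[of a f] unfolding mem_iff by blast
  then have "elts b = f ` X"
    using a by blast
  then show ?thesis
    unfolding small_def by blast
qed

text \<open>Replacement for \<open>X \<mapsto> vset (F X)\<close> turns the family into one set, to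
  which the union axiom applies.\<close>

lemma small_Union:
  fixes F :: "'a::zfc_universe \<Rightarrow> 'a set"
  assumes "small I" "\<And>X. X \<in> I \<Longrightarrow> small (F X)"
  shows "small (\<Union>X\<in>I. F X)"
proof -
  have "small ((\<lambda>X. vset (F X)) ` I)"
    using assms by simp
  then obtain a where a: "elts a = (\<lambda>X. vset (F X)) ` I"
    unfolding small_def by blast
  obtain b where "\<forall>x. x \<in> elts b \<longleftrightarrow> (\<exists>y. y \<in> elts a \<and> x \<in> elts y)"
    using union[of a] unfolding mem_iff by blast
  then have "elts b = (\<Union>y\<in>elts a. elts y)"
    by blast
  then have "elts b = (\<Union>X\<in>I. F X)"
    unfolding a using assms by simp
  then show ?thesis
    unfolding small_def by blast
qed

lemma small_pair [simp]: "small {a, b}"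
proof -
  obtain c where "\<forall>x. x \<in> elts c \<longleftrightarrow> x = a \<or> x = b"
    using pairing[of a b] unfolding mem_iff by blast
  then have "elts c = {a, b}"
    by blast
  then show ?thesis
    unfolding small_def by blast
qed

lemma small_singleton [simp]: "small {a}"
  using small_pair[of a a] by simp

lemma small_empty [simp]: "small {}"
  using small_subset[OF small_singleton] by blast

lemma small_Un [simp]: "small (X \<union> Y)" if "small X" "small Y"
proof -
  have "small (\<Union>z\<in>{vset X, vset Y}. elts z)"
    by (rule small_Union) auto
  then show ?thesis
    using that by simp
qed

lemma small_Pow: "small {x. elts x \<subseteq> elts a}"
proof -
  obtain b where "\<forall>x. x \<in> elts b \<longleftrightarrow> (\<forall>y. y \<in> elts x \<longrightarrow> y \<in> elts a)"
    using power_set[of a] unfolding mem_iff by blast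
  then have "elts b = {x. elts x \<subseteq> elts a}"
    by blast
  then show ?thesis
    unfolding small_def by blast
qed

lemma opair_inject [simp]: "opair a b = opair c d \<longleftrightarrow> a = c \<and> b = d"
proof -
  have "opair a b = opair c d \<longleftrightarrow> {vset {a}, vset {a, b}} = {vset {c}, vset {c, d}}"
    unfolding opair_def by (metis elts_vset small_pair)
  also have "\<dots> \<longleftrightarrow> {{a}, {a, b}} = {{c}, {c, d}}" (is "?l = ?r")
  proof
    assume ?l
    then have "elts ` {vset {a}, vset {a, b}} = elts ` {vset {c}, vset {c, d}}"
      by simp
    then show ?r by simp
  next
    assume ?r
    then have "vset ` {{a}, {a, b}} = vset ` {{c}, {c, d}}"
      by simp
    then show ?l by simp
  qed
  also have "\<dots> \<longleftrightarrow> a = c \<and> b = d"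
    by (auto simp: doubleton_eq_iff)
  finally show ?thesis .
qed

definition vprod :: "'a::zfc_universe \<Rightarrow> 'a \<Rightarrow> 'a" where
  "vprod a b = vset {opair x y |x y. x \<in> elts a \<and> y \<in> elts b}"

lemma opair_in_vprod [simp]: "opair x y \<in> elts (vprod a b) \<longleftrightarrow> x \<in> elts a \<and> y \<in> elts b"
proof -
  have "small (\<Union>x\<in>elts a. opair x ` elts b)"
    by (rule small_Union) auto
  then have "small {opair x y |x y. x \<in> elts a \<and> y \<in> elts b}"
    by (rule small_subset) auto
  then have "elts (vprod a b) = {opair x y |x y. x \<in> elts a \<and> y \<in> elts b}"
    unfolding vprod_def by simp
  then show ?thesis by auto
qed

text \<open>Separation on a product. It puts a HOL relation between two sets into the universe, so
  that an embedding can act on it.\<close>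

lemma set_relation2:
  "\<exists>r. \<forall>x y. opair x y \<in> elts r \<longleftrightarrow> x \<in> elts a \<and> y \<in> elts b \<and> P x y"
proof -
  let ?X = "{p \<in> elts (vprod a b). \<exists>x y. p = opair x y \<and> P x y}"
  have "small ?X"
    by (rule small_subset[OF small_elts]) auto
  then show ?thesis
    by (intro exI[of _ "vset ?X"]) auto
qed

lemma set_relation3:
  "\<exists>r. \<forall>x y z. opair x (opair y z) \<in> elts r \<longleftrightarrow>
     x \<in> elts a \<and> y \<in> elts b \<and> z \<in> elts c \<and> P x y z"
proof -
  obtain r where "\<forall>x w. opair x w \<in> elts r \<longleftrightarrow>
      x \<in> elts a \<and> w \<in> elts (vprod b c) \<and> (\<exists>y z. w = opair y z \<and> P x y z)"
    using set_relation2[of a "vprod b c" "\<lambda>x w. \<exists>y z. w = opair y z \<and> P x y z"] by blast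
  then show ?thesis
    by (intro exI[of _ r]) auto
qed

lemma set_relation4:
  "\<exists>r. \<forall>x y z w. opair x (opair y (opair z w)) \<in> elts r \<longleftrightarrow>
     x \<in> elts a \<and> y \<in> elts b \<and> z \<in> elts c \<and> w \<in> elts d \<and> P x y z w"
proof -
  obtain r where "\<forall>x y v. opair x (opair y v) \<in> elts r \<longleftrightarrow>
      x \<in> elts a \<and> y \<in> elts b \<and> v \<in> elts (vprod c d) \<and> (\<exists>z w. v = opair z w \<and> P x y z w)"
    using set_relation3[of a b "vprod c d" "\<lambda>x y v. \<exists>z w. v = opair z w \<and> P x y z w"] by blast
  then show ?thesis
    by (intro exI[of _ r]) auto
qed

section \<open>Well-foundedness, ordinals and collapse\<close>

lemma not_mem_self: "x \<notin> elts x"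
proof
  assume "x \<in> elts x"
  have "\<exists>y \<in> elts (vset {x}). \<forall>z \<in> elts y. z \<notin> elts (vset {x})"
    using foundation[of x "vset {x}"] unfolding mem_iff by auto
  then have "\<forall>z \<in> elts x. z \<noteq> x" by simp
  with \<open>x \<in> elts x\<close> show False by blast
qed

text \<open>Infinity supplies a set closed under the successor \<open>x \<union> {x}\<close>;
  iterating from some element \<open>z\<close> of it gives distinct values, and Replacement carries
  these to the values of \<open>F\<close>. All HOL sequences are covered, which is what
  \<open>wf\<close> requires.\<close>

lemma small_range_nat: "small (range F)" for F :: "nat \<Rightarrow> 'a::zfc_universe"
proof -
  obtain a z where z: "(z::'a) \<in> elts a"
    and s: "\<And>x. x \<in> elts a \<Longrightarrow> \<exists>s. s \<in> elts a \<and> (\<forall>y. y \<in> elts s \<longleftrightarrow> y \<in> elts x \<or> y = x)"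
    using infinity unfolding mem_iff by blast
  define N :: "nat \<Rightarrow> 'a" where "N = rec_nat z (\<lambda>n x. vset (insert x (elts x)))"
  have sm: "small (insert x (elts x))" for x :: 'a
    using small_Un[OF small_singleton small_elts] by auto
  have N: "N 0 = z" "N (Suc n) = vset (insert (N n) (elts (N n)))" for n
    by (simp_all add: N_def)
  have Na: "N n \<in> elts a" for n
  proof (induction n)
    case 0
    then show ?case using z N by simp
  next
    case (Suc n)
    then obtain t where t: "t \<in> elts a" "elts t = insert (N n) (elts (N n))"
      using s[of "N n"] by blast
    then have "t = N (Suc n)"
      by (metis N(2) vset_elts)
    with t show ?case by simp
  qed
  have mono: "m < n \<Longrightarrow> N m \<in> elts (N n)" for m n
    by (induction n) (auto simp: N sm less_Suc_eq)
  have inj: "inj N"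
    by (metis mono not_mem_self linorder_injI)
  have "small (range N)"
    by (rule small_subset[OF small_elts[of a]]) (use Na in auto)
  then have "small ((F \<circ> inv N) ` range N)"
    by (rule small_image)
  then show ?thesis
    using inj by (simp add: image_comp)
qed

text \<open>The range of a descending HOL sequence would be a set without a minimal element, against
  Foundation.\<close>

lemma wf_mem: "wf {(x, y). x \<in> elts y}"
  unfolding wf_iff_no_infinite_down_chain
proof clarify
  fix f :: "nat \<Rightarrow> 'a"
  assume f: "\<forall>i. (f (Suc i), f i) \<in> {(x, y). x \<in> elts y}"
  let ?R = "vset (range f)"
  have R: "elts ?R = range f"
    by (simp add: small_range_nat)
  obtain y where "y \<in> elts ?R" "\<forall>z \<in> elts y. z \<notin> elts ?R"
    using foundation[of "f 0" ?R] R unfolding mem_iff by auto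
  then obtain n where "f (Suc n) \<notin> elts (f n)"
    unfolding R by auto
  with f show False by simp
qed

lemma mem_induct [case_names step]:
  assumes "\<And>x. (\<And>y. y \<in> elts x \<Longrightarrow> P y) \<Longrightarrow> P x"
  shows "P x"
  using wf_mem by (rule wf_induct_rule) (use assms in auto)

lemma mem_minimal: "P d \<Longrightarrow> \<exists>e. P e \<and> (\<forall>b\<in>elts e. \<not> P b)"
  by (induction d rule: mem_induct) blast

lemma Ord_in_Ord: "Ord a \<Longrightarrow> x \<in> elts a \<Longrightarrow> Ord x"
  unfolding Ord_def vtransitive_def by blast

lemma Ord_trans: "Ord a \<Longrightarrow> x \<in> elts a \<Longrightarrow> y \<in> elts x \<Longrightarrow> y \<in> elts a"
  unfolding Ord_def vtransitive_def by blast

text \<open>Double induction: if the members of each ordinal are already comparable with the other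
  one, incomparability would force each to contain the other, hence equality.\<close>

lemma Ord_linear:
  assumes "Ord a" "Ord b"
  shows "a \<in> elts b \<or> a = b \<or> b \<in> elts a"
  using assms
proof (induction a arbitrary: b rule: mem_induct)
  case (step a)
  note IHa = step.IH
  from step.prems(2) show ?case
  proof (induction b rule: mem_induct)
    case (step b)
    note IHb = step.IH
    show ?case
    proof (rule ccontr)
      assume n: "\<not> ?thesis"
      have "x \<in> elts b" if x: "x \<in> elts a" for x
        using IHa[OF x Ord_in_Ord[OF \<open>Ord a\<close> x] \<open>Ord b\<close>] n x Ord_trans[OF \<open>Ord a\<close> x] by blast
      moreover have "y \<in> elts a" if y: "y \<in> elts b" for y
        using IHb[OF y Ord_in_Ord[OF \<open>Ord b\<close> y]] n y Ord_trans[OF \<open>Ord b\<close> y] by blast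
      ultimately have "a = b"
        by (intro elts_eqI) blast
      with n show False by blast
    qed
  qed
qed

text \<open>This is the Mostowski collapse of \<open>R\<close> on \<open>X\<close>. Transitivity of
  \<open>R\<close> makes the values ordinals. Totality makes the collapse injective, since of two
  distinct points one has its value inside the value of the other.\<close>

lemma collapse_exists:
  fixes X :: "'a::zfc_universe set"
  assumes wf: "wf R" and tr: "trans R" and tot: "\<And>x y. x \<in> X \<Longrightarrow> y \<in> X \<Longrightarrow> x \<noteq> y \<Longrightarrow> (x, y) \<in> R \<or> (y, x) \<in> R"
    and sm: "small X"
  shows "\<exists>c :: 'a \<Rightarrow> 'a. (\<forall>x\<in>X. elts (c x) = c ` {y \<in> X. (y, x) \<in> R} \<and> Ord (c x)) \<and> inj_on c X"
proof -
  define H :: "('a \<Rightarrow> 'a) \<Rightarrow> 'a \<Rightarrow> 'a" where "H = (\<lambda>f x. vset (f ` {y \<in> X. (y, x) \<in> R}))"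
  define c where "c = wfrec R H"
  have adm: "adm_wf R H"
    unfolding adm_wf_def H_def by (auto intro!: arg_cong[where f = vset] image_cong)
  have c: "elts (c x) = c ` {y \<in> X. (y, x) \<in> R}" for x
  proof -
    have "c x = vset (c ` {y \<in> X. (y, x) \<in> R})"
      unfolding c_def by (subst wfrec_fixpoint[OF wf adm]) (simp add: H_def)
    moreover have "small {y \<in> X. (y, x) \<in> R}"
      by (rule small_subset[OF sm]) auto
    ultimately show ?thesis by simp
  qed
  have t: "vtransitive (c x)" for x
    unfolding vtransitive_def
  proof (intro ballI subsetI)
    fix z w assume "z \<in> elts (c x)" "w \<in> elts z"
    then obtain y v where "(y, x) \<in> R" "w = c v" "v \<in> X" "(v, y) \<in> R"
      unfolding c by (auto simp: c)
    then show "w \<in> elts (c x)"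
      unfolding c using transD[OF tr] by blast
  qed
  have "Ord (c x)" for x
    unfolding Ord_def c[of x] using t by auto
  moreover have "inj_on c X"
  proof (rule inj_onI, rule ccontr)
    fix x y assume xy: "x \<in> X" "y \<in> X" "c x = c y" "x \<noteq> y"
    then have "c x \<in> elts (c y) \<or> c y \<in> elts (c x)"
      using tot c by blast
    with xy show False
      using not_mem_self by metis
  qed
  ultimately show ?thesis
    using c by (intro exI[of _ c] conjI ballI) auto
qed

text \<open>Zermelo's theorem for a whole type, in strict form; one relation then well-orders every
  set by restriction.\<close>

lemma well_order_type: "\<exists>W :: ('b \<times> 'b) set. wf W \<and> trans W \<and> (\<forall>x y. x \<noteq> y \<longrightarrow> (x, y) \<in> W \<or> (y, x) \<in> W)"
proof -
  obtain r :: "('b \<times> 'b) set" where r: "well_order_on UNIV r"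
    using well_order_on by blast
  then have "wf (r - Id)" "antisym r" "trans r" "total_on UNIV r"
    unfolding well_order_on_def linear_order_on_def partial_order_on_def preorder_on_def by auto
  then show ?thesis
    by (intro exI[of _ "r - Id"]) (auto simp: trans_diff_Id total_on_def)
qed

section \<open>Bijections and cardinals\<close>

lemma Ex1_bounded:
  assumes "\<And>y. R y \<Longrightarrow> y \<in> B"
  shows "(\<exists>!y. R y) \<longleftrightarrow> (\<exists>y\<in>B. R y) \<and> (\<forall>y\<in>B. \<forall>z\<in>B. R y \<longrightarrow> R z \<longrightarrow> y = z)"
  using assms by blast

text \<open>Since every member of \<open>f\<close> is a pair from \<open>a\<close> and
  \<open>b\<close>, the uniqueness conditions can be bounded by \<open>a\<close> and
  \<open>b\<close>. In this form being a bijection is visibly absolute between transitive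
  classes.\<close>

lemma is_bijection_alt:
  "is_bijection f a b \<longleftrightarrow>
    (\<forall>p\<in>elts f. \<exists>x\<in>elts a. \<exists>y\<in>elts b. p = opair x y) \<and>
    (\<forall>x\<in>elts a. \<exists>y\<in>elts b. opair x y \<in> elts f) \<and>
    (\<forall>x\<in>elts a. \<forall>y\<in>elts b. \<forall>z\<in>elts b. opair x y \<in> elts f \<longrightarrow> opair x z \<in> elts f \<longrightarrow> y = z) \<and>
    (\<forall>y\<in>elts b. \<exists>x\<in>elts a. opair x y \<in> elts f) \<and>
    (\<forall>x\<in>elts a. \<forall>z\<in>elts a. \<forall>y\<in>elts b. opair x y \<in> elts f \<longrightarrow> opair z y \<in> elts f \<longrightarrow> x = z)"
  (is "?l \<longleftrightarrow> ?P \<and> ?Q")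
proof (cases ?P)
  case True
  then have h: "x \<in> elts a" "y \<in> elts b" if "opair x y \<in> elts f" for x y
    using that by (metis opair_inject)+
  have "(\<exists>!y. opair x y \<in> elts f) \<longleftrightarrow> (\<exists>y\<in>elts b. opair x y \<in> elts f) \<and>
      (\<forall>y\<in>elts b. \<forall>z\<in>elts b. opair x y \<in> elts f \<longrightarrow> opair x z \<in> elts f \<longrightarrow> y = z)" for x
    by (rule Ex1_bounded) (rule h)
  moreover have "(\<exists>!x. opair x y \<in> elts f) \<longleftrightarrow> (\<exists>x\<in>elts a. opair x y \<in> elts f) \<and>
      (\<forall>x\<in>elts a. \<forall>z\<in>elts a. opair x y \<in> elts f \<longrightarrow> opair z y \<in> elts f \<longrightarrow> x = z)" for y
    by (rule Ex1_bounded) (rule h)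
  ultimately show ?thesis
    using True unfolding is_bijection_def is_function_def by (simp only:) blast
next
  case False
  then show ?thesis
    unfolding is_bijection_def is_function_def by blast
qed

lemma bijection_iff: "(\<exists>f. is_bijection f a b) \<longleftrightarrow> (\<exists>g. bij_betw g (elts a) (elts b))"
proof
  assume "\<exists>f. is_bijection f a b"
  then obtain f where f: "is_bijection f a b" ..
  then obtain g where "\<And>x. x \<in> elts a \<Longrightarrow> g x \<in> elts b \<and> opair x (g x) \<in> elts f"
    unfolding is_bijection_alt by metis
  with f have "bij_betw g (elts a) (elts b)"
    unfolding is_bijection_alt by (intro bij_betw_imageI inj_onI) (metis, blast)
  then show "\<exists>g. bij_betw g (elts a) (elts b)" by blast
next
  assume "\<exists>g. bij_betw g (elts a) (elts b)"
  then obtain g where g: "bij_betw g (elts a) (elts b)" ..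
  let ?f = "vset ((\<lambda>x. opair x (g x)) ` elts a)"
  have f: "elts ?f = (\<lambda>x. opair x (g x)) ` elts a"
    by simp
  have f': "opair x y \<in> elts ?f \<longleftrightarrow> x \<in> elts a \<and> y = g x" for x y
    by auto
  have gb: "g x \<in> elts b" if "x \<in> elts a" for x
    using g that by (rule bij_betwE[rule_format])
  have "is_bijection ?f a b"
    unfolding is_bijection_alt f'
  proof (intro conjI ballI impI)
    fix p assume "p \<in> elts ?f"
    then show "\<exists>x\<in>elts a. \<exists>y\<in>elts b. p = opair x y"
      unfolding f using gb by blast
  next
    fix y assume "y \<in> elts b"
    then show "\<exists>x\<in>elts a. x \<in> elts a \<and> y = g x"
      using bij_betw_imp_surj_on[OF g] by blast
  next
    fix x z y assume "x \<in> elts a \<and> y = g x" "z \<in> elts a \<and> y = g z"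
    then show "x = z"
      using bij_betw_imp_inj_on[OF g] by (auto dest: inj_onD)
  qed (use gb in blast)+
  then show "\<exists>f. is_bijection f a b" ..
qed

text \<open>Collapsing \<open>a\<close> along a well-order of the universe maps it bijectively onto
  a transitive set of ordinals.\<close>

lemma bijection_Ord_exists: "\<exists>d. Ord d \<and> (\<exists>f. is_bijection f a d)" for a :: "'a::zfc_universe"
proof -
  obtain W :: "('a \<times> 'a) set" where W: "wf W \<and> trans W \<and> (\<forall>x y. x \<noteq> y \<longrightarrow> (x, y) \<in> W \<or> (y, x) \<in> W)"
    using well_order_type[where 'b = 'a] ..
  obtain c :: "'a \<Rightarrow> 'a" where c: "\<forall>x\<in>elts a. elts (c x) = c ` {y \<in> elts a. (y, x) \<in> W} \<and> Ord (c x)"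
    and inj: "inj_on c (elts a)"
    using collapse_exists[of W "elts a"] W by auto
  let ?d = "vset (c ` elts a)"
  have d: "elts ?d = c ` elts a"
    by simp
  have "Ord ?d"
    using c unfolding Ord_def vtransitive_def d by fastforce
  moreover have "bij_betw c (elts a) (elts ?d)"
    using inj d by (simp add: bij_betw_def)
  ultimately show ?thesis
    unfolding bijection_iff by blast
qed

text \<open>One ordinal in bijection with \<open>a\<close> inside \<open>M\<close> suffices for the
  definite description to denote: a membership-minimal one exists, and linearity of the ordinals
  makes it unique.\<close>

lemma card_in:
  assumes "Ord d" "f \<in> M" "is_bijection f a d"
  shows "Ord (card_in M a)" "\<exists>f\<in>M. is_bijection f a (card_in M a)"
    "b \<in> elts (card_in M a) \<Longrightarrow> \<not> (\<exists>f\<in>M. is_bijection f a b)"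
proof -
  let ?P = "\<lambda>d. Ord d \<and> (\<exists>f\<in>M. is_bijection f a d)"
  have "\<exists>e. ?P e \<and> (\<forall>b\<in>elts e. \<not> ?P b)"
    by (rule mem_minimal[of _ d]) (use assms in blast)
  then obtain e where e: "?P e" "\<forall>b\<in>elts e. \<not> (\<exists>f\<in>M. is_bijection f a b)"
    using Ord_in_Ord by blast
  have "card_in M a = e"
    unfolding card_in_def using e Ord_linear by (intro the_equality) blast+
  with e show "Ord (card_in M a)" "\<exists>f\<in>M. is_bijection f a (card_in M a)"
    "b \<in> elts (card_in M a) \<Longrightarrow> \<not> (\<exists>f\<in>M. is_bijection f a b)"
    by auto
qed

lemma vcard:
  shows "Ord (vcard a)" "\<exists>f. is_bijection f a (vcard a)"
    "b \<in> elts (vcard a) \<Longrightarrow> \<not> (\<exists>g. bij_betw g (elts a) (elts b))"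
  using card_in[of _ _ UNIV] bijection_Ord_exists[of a] bijection_iff by (metis UNIV_I)+

lemma bij_betw_inj_into:
  assumes "bij_betw g A B" "\<exists>h. inj_on h B \<and> h ` B \<subseteq> C"
  shows "\<exists>h. inj_on h A \<and> h ` A \<subseteq> C"
proof -
  obtain h where "inj_on h B" "h ` B \<subseteq> C"
    using assms(2) by blast
  then have "inj_on (h \<circ> g) A" "(h \<circ> g) ` A \<subseteq> C"
    using assms(1) by (auto simp: bij_betw_def intro: comp_inj_on)
  then show ?thesis by blast
qed

text \<open>The least ordinal \<open>l\<close> that does not inject into \<open>k\<close> is the
  successor cardinal. Such ordinals exist because the power set of \<open>k\<close> does not inject
  into \<open>k\<close> but is in bijection with an ordinal.\<close>

lemma card_succ:
  fixes k :: "'a::zfc_universe"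
  assumes "Ord k"
  shows "Ord (card_succ k)" "k \<in> elts (card_succ k)"
    "a \<in> elts (card_succ k) \<Longrightarrow> \<exists>g. inj_on g (elts a) \<and> g ` elts a \<subseteq> elts k"
proof -
  define I where "I = (\<lambda>a :: 'a. \<exists>g. inj_on g (elts a) \<and> g ` elts a \<subseteq> elts k)"
  have I_bij: "I a" if "bij_betw g (elts a) (elts b)" "I b" for a b g
    using that bij_betw_inj_into[of g "elts a" "elts b" "elts k"] unfolding I_def by blast
  let ?pow = "vset {x. elts x \<subseteq> elts k}"
  have "\<not> I ?pow"
  proof
    assume "I ?pow"
    then obtain f where f: "inj_on f (elts ?pow)" "f ` elts ?pow \<subseteq> elts k"
      unfolding I_def by blast
    have p: "elts ?pow = {x. elts x \<subseteq> elts k}"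
      by (simp add: small_Pow)
    \<comment> \<open>Cantor's diagonal set, moved into \<open>k\<close> by the supposed injection
      \<open>f\<close>.\<close>
    define x0 where "x0 = vset {f x |x. elts x \<subseteq> elts k \<and> f x \<notin> elts x}"
    have sub: "{f x |x. elts x \<subseteq> elts k \<and> f x \<notin> elts x} \<subseteq> elts k"
      using f p by auto
    have x0: "elts x0 = {f x |x. elts x \<subseteq> elts k \<and> f x \<notin> elts x}"
      unfolding x0_def by (rule elts_vset, rule small_subset[OF small_elts sub])
    have x0k: "elts x0 \<subseteq> elts k"
      using sub x0 by simp
    have "f x0 \<in> elts x0 \<longleftrightarrow> f x0 \<notin> elts x0"
    proof
      assume "f x0 \<in> elts x0"
      then obtain x where x: "elts x \<subseteq> elts k" "f x \<notin> elts x" "f x0 = f x"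
        unfolding x0 by blast
      have "x \<in> elts ?pow" "x0 \<in> elts ?pow"
        unfolding p using x(1) x0k by simp_all
      then have "x = x0"
        using inj_onD[OF f(1) x(3)[symmetric]] by blast
      with x(2) show "f x0 \<notin> elts x0" by simp
    next
      assume "f x0 \<notin> elts x0"
      then show "f x0 \<in> elts x0"
        using x0 x0k by blast
    qed
    then show False by blast
  qed
  moreover obtain d0 :: 'a and g where d0: "Ord d0" "bij_betw g (elts ?pow) (elts d0)"
    using bijection_Ord_exists[of ?pow] unfolding bijection_iff by blast
  ultimately have "\<not> I d0"
    using I_bij by blast
  then have "\<exists>l. (Ord l \<and> \<not> I l) \<and> (\<forall>b\<in>elts l. \<not> (Ord b \<and> \<not> I b))"
    using d0(1) by (intro mem_minimal[where P = "\<lambda>l. Ord l \<and> \<not> I l" and d = d0] conjI)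
  then obtain l :: 'a where l: "Ord l" "\<not> I l" "\<And>b. b \<in> elts l \<Longrightarrow> I b"
    using Ord_in_Ord by blast
  have "I k"
    unfolding I_def by (intro exI[of _ id]) simp
  moreover have "I l" if "l \<in> elts k"
    unfolding I_def using Ord_trans[OF assms that] by (intro exI[of _ id]) auto
  ultimately have kl: "k \<in> elts l"
    using Ord_linear[OF assms l(1)] l(2) by blast
  have "\<not> l \<in> elts (vcard l)"
    using vcard(3)[of l l] bij_betw_id by blast
  moreover have "\<not> vcard l \<in> elts l"
  proof
    assume "vcard l \<in> elts l"
    moreover obtain g where "bij_betw g (elts l) (elts (vcard l))"
      using vcard(2)[of l] unfolding bijection_iff by blast
    ultimately have "I l"
      using l(3) I_bij by blast
    with l(2) show False by blast
  qed
  ultimately have "vcard l = l"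
    using Ord_linear[OF l(1) vcard(1)] by metis
  then have cl: "Card l"
    using l(1) unfolding Card_def by blast
  \<comment> \<open>By minimality of \<open>l\<close> such an \<open>m\<close> injects into
    \<open>k\<close>, so Schroeder-Bernstein would make the cardinal \<open>m\<close> equinumerous
    with its member \<open>k\<close>.\<close>
  have min: "\<not> (Card m \<and> k \<in> elts m)" if m: "m \<in> elts l" for m
  proof
    assume a: "Card m \<and> k \<in> elts m"
    then have sub: "elts k \<subseteq> elts m"
      unfolding Card_def using Ord_trans by blast
    obtain g where "inj_on g (elts m)" "g ` elts m \<subseteq> elts k"
      using l(3)[OF m] unfolding I_def by blast
    then have "\<exists>g. bij_betw g (elts m) (elts k)"
      using Schroeder_Bernstein[of g "elts m" "elts k" id] sub by auto
    then show False
      using a vcard(3)[of k m] unfolding Card_def by metis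
  qed
  have "card_succ k = l"
    unfolding card_succ_def
  proof (rule the_equality)
    show "Card l \<and> k \<^bold>\<in> l \<and> (\<forall>m\<in>elts l. \<not> (Card m \<and> k \<^bold>\<in> m))"
      using cl kl min by (simp add: mem_iff)
  next
    fix l' assume "Card l' \<and> k \<^bold>\<in> l' \<and> (\<forall>m\<in>elts l'. \<not> (Card m \<and> k \<^bold>\<in> m))"
    then have l': "Card l'" "k \<in> elts l'" "\<forall>m\<in>elts l'. \<not> (Card m \<and> k \<in> elts m)"
      by (simp_all add: mem_iff)
    then have "Ord l'"
      unfolding Card_def by blast
    then show "l' = l"
      using Ord_linear[OF l(1), of l'] l' cl kl min by blast
  qed
  with l kl show "Ord (card_succ k)" "k \<in> elts (card_succ k)"
    "a \<in> elts (card_succ k) \<Longrightarrow> \<exists>g. inj_on g (elts a) \<and> g ` elts a \<subseteq> elts k"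
    unfolding I_def by auto
qed

section \<open>Definability and elementary embeddings\<close>

text \<open>
  The introduction rules for \<open>definable\<close> are higher-order patterns: passing under a quantifier shifts every variable \<open>e n\<close> to
  \<open>e (Suc n)\<close> by beta reduction, so that definability goals are solved by \<open>intro\<close>.
\<close>

definition definable :: "('a::zfc_universe set \<Rightarrow> (nat \<Rightarrow> 'a) \<Rightarrow> bool) \<Rightarrow> bool" where
  "definable P \<longleftrightarrow> (\<exists>p. \<forall>M e. (\<forall>x\<in>M. elts x \<subseteq> M) \<longrightarrow> range e \<subseteq> M \<longrightarrow> (sat M e p \<longleftrightarrow> P M e))"

named_theorems dfn

lemma dfn_mem [dfn]: "definable (\<lambda>M e. e m \<in> elts (e n))"
  unfolding definable_def by (rule exI[of _ "Mem m n"]) (simp add: mem_iff)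

lemma dfn_eq [dfn]: "definable (\<lambda>M e. e m = e n)"
  unfolding definable_def by (rule exI[of _ "Eq m n"]) simp

lemma dfn_not [dfn]:
  assumes "definable P"
  shows "definable (\<lambda>M e. \<not> P M e)"
proof -
  obtain p where "\<forall>M e. (\<forall>x\<in>M. elts x \<subseteq> M) \<longrightarrow> range e \<subseteq> M \<longrightarrow> (sat M e p \<longleftrightarrow> P M e)"
    using assms unfolding definable_def ..
  then show ?thesis
    unfolding definable_def by (intro exI[of _ "Neg p"]) simp
qed

lemma dfn_conj [dfn]:
  assumes "definable P" "definable Q"
  shows "definable (\<lambda>M e. P M e \<and> Q M e)"
proof -
  obtain p q where "\<forall>M e. (\<forall>x\<in>M. elts x \<subseteq> M) \<longrightarrow> range e \<subseteq> M \<longrightarrow> (sat M e p \<longleftrightarrow> P M e)"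
    "\<forall>M e. (\<forall>x\<in>M. elts x \<subseteq> M) \<longrightarrow> range e \<subseteq> M \<longrightarrow> (sat M e q \<longleftrightarrow> Q M e)"
    using assms unfolding definable_def by blast
  then show ?thesis
    unfolding definable_def by (intro exI[of _ "Conj p q"]) simp
qed

lemma dfn_all [dfn]:
  assumes "definable (\<lambda>M e. P M (\<lambda>n. e (Suc n)) (e 0))"
  shows "definable (\<lambda>M e. \<forall>x\<in>M. P M e x)"
proof -
  obtain p where p: "\<And>M e. \<lbrakk>\<forall>x\<in>M. elts x \<subseteq> M; range e \<subseteq> M\<rbrakk> \<Longrightarrow> sat M e p \<longleftrightarrow> P M (\<lambda>n. e (Suc n)) (e 0)"
    using assms unfolding definable_def by blast
  have "sat M e (All p) \<longleftrightarrow> (\<forall>x\<in>M. P M e x)" if "\<forall>x\<in>M. elts x \<subseteq> M" "range e \<subseteq> M" for M e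
  proof -
    have "e n \<in> M" for n
      using \<open>range e \<subseteq> M\<close> by blast
    then have "range (case_nat x e) \<subseteq> M" if "x \<in> M" for x
      using that by (auto split: nat.splits)
    then show ?thesis
      using p[OF that(1)] by simp
  qed
  then show ?thesis
    unfolding definable_def by blast
qed

lemma dfn_disj [dfn]:
  assumes "definable P" "definable Q"
  shows "definable (\<lambda>M e. P M e \<or> Q M e)"
proof -
  have "definable (\<lambda>M e. \<not> (\<not> P M e \<and> \<not> Q M e))"
    by (intro dfn assms)
  then show ?thesis by simp
qed

lemma dfn_imp [dfn]:
  assumes "definable P" "definable Q"
  shows "definable (\<lambda>M e. P M e \<longrightarrow> Q M e)"
  unfolding imp_conv_disj by (intro dfn assms)

lemma dfn_iff [dfn]:
  assumes "definable P" "definable Q"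
  shows "definable (\<lambda>M e. P M e \<longleftrightarrow> Q M e)"
  unfolding iff_conv_conj_imp by (intro dfn assms)

lemma dfn_ex [dfn]:
  assumes "definable (\<lambda>M e. P M (\<lambda>n. e (Suc n)) (e 0))"
  shows "definable (\<lambda>M e. \<exists>x\<in>M. P M e x)"
proof -
  have "definable (\<lambda>M e. \<not> (\<forall>x\<in>M. \<not> P M e x))"
    by (intro dfn assms)
  then show ?thesis by simp
qed

text \<open>Equivalence is demanded only for transitive classes and assignments into them, which is
  what gives access to bounded quantifiers.\<close>

lemma definable_cong:
  assumes "definable P"
    and "\<And>M e. \<forall>x\<in>M. elts x \<subseteq> M \<Longrightarrow> range e \<subseteq> M \<Longrightarrow> P M e \<longleftrightarrow> Q M e"
  shows "definable Q"
proof -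
  obtain p where "\<And>M e. \<lbrakk>\<forall>x\<in>M. elts x \<subseteq> M; range e \<subseteq> M\<rbrakk> \<Longrightarrow> sat M e p \<longleftrightarrow> P M e"
    using assms(1) unfolding definable_def by blast
  with assms(2) show ?thesis
    unfolding definable_def by (intro exI[of _ p]) simp
qed

text \<open>Transitivity of \<open>M\<close> keeps the members of \<open>e n\<close> inside
  \<open>M\<close>, so bounding by \<open>e n\<close> agrees with a relativised implication.\<close>

lemma dfn_ball [dfn]:
  assumes "definable (\<lambda>M e. P M (\<lambda>n. e (Suc n)) (e 0))"
  shows "definable (\<lambda>M e. \<forall>x\<in>elts (e n). P M e x)"
proof (rule definable_cong)
  show "definable (\<lambda>M e. \<forall>x\<in>M. x \<in> elts (e n) \<longrightarrow> P M e x)"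
    by (intro dfn assms)
next
  fix M and e :: "nat \<Rightarrow> 'a"
  assume "\<forall>x\<in>M. elts x \<subseteq> M" "range e \<subseteq> M"
  then have "elts (e n) \<subseteq> M" by blast
  then show "(\<forall>x\<in>M. x \<in> elts (e n) \<longrightarrow> P M e x) \<longleftrightarrow> (\<forall>x\<in>elts (e n). P M e x)"
    by blast
qed

lemma dfn_bex [dfn]:
  assumes "definable (\<lambda>M e. P M (\<lambda>n. e (Suc n)) (e 0))"
  shows "definable (\<lambda>M e. \<exists>x\<in>elts (e n). P M e x)"
proof -
  have "definable (\<lambda>M e. \<not> (\<forall>x\<in>elts (e n). \<not> P M e x))"
    by (intro dfn assms)
  then show ?thesis by simp
qed

lemma dfn_subset [dfn]: "definable (\<lambda>M e. elts (e m) \<subseteq> elts (e n))"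
  unfolding subset_iff by (rule definable_cong[where P = "\<lambda>M e. \<forall>x\<in>elts (e m). x \<in> elts (e n)"])
    (intro dfn, blast)

text \<open>The Kuratowski pair with all quantifiers bounded by \<open>p\<close> and its members,
  hence absolute; \<open>u\<close> is the singleton and \<open>v\<close> the doubleton.\<close>

lemma opair_iff:
  "p = opair x y \<longleftrightarrow> (\<exists>u\<in>elts p. \<exists>v\<in>elts p. (\<forall>w\<in>elts p. w = u \<or> w = v) \<and>
     x \<in> elts u \<and> (\<forall>w\<in>elts u. w = x) \<and> x \<in> elts v \<and> y \<in> elts v \<and> (\<forall>w\<in>elts v. w = x \<or> w = y))"
  (is "_ \<longleftrightarrow> ?R")
proof
  have *: "elts (opair x y) = {vset {x}, vset {x, y}}"
    unfolding opair_def by simp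
  show "p = opair x y \<Longrightarrow> ?R"
    unfolding * by (simp add: *)
next
  assume ?R
  then obtain u v where "elts p = {u, v}" "elts u = {x}" "elts v = {x, y}"
    by blast
  then show "p = opair x y"
    unfolding opair_def by (metis vset_elts)
qed

lemma dfn_opair_eq [dfn]: "definable (\<lambda>M e. e k = opair (e m) (e n))"
  unfolding opair_iff by (intro dfn)

lemma dfn_opair [dfn]: "definable (\<lambda>M e. opair (e m) (e n) \<in> elts (e k))"
proof -
  have *: "opair x y \<in> elts r \<longleftrightarrow> (\<exists>p\<in>elts r. p = opair x y)" for x y r :: 'a
    by blast
  show ?thesis
    unfolding * by (intro dfn)
qed

text \<open>Bounds the inner pair of a triple or quadruple: it is a member of a member of the outer
  pair.\<close>

lemma opair_right: "\<exists>u\<in>elts (opair x y). y \<in> elts u"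
  unfolding opair_def by simp

lemma dfn_opair3_eq: "definable (\<lambda>M e. e k = opair (e l) (opair (e m) (e n)))"
proof -
  have *: "p = opair x (opair y z) \<longleftrightarrow> (\<exists>u\<in>elts p. \<exists>q\<in>elts u. p = opair x q \<and> q = opair y z)" for p x y z :: 'a
    using opair_right by blast
  show ?thesis
    unfolding * by (intro dfn)
qed

lemma dfn_opair3 [dfn]: "definable (\<lambda>M e. opair (e l) (opair (e m) (e n)) \<in> elts (e k))"
proof -
  have *: "opair x (opair y z) \<in> elts r \<longleftrightarrow> (\<exists>p\<in>elts r. p = opair x (opair y z))" for x y z r :: 'a
    by blast
  show ?thesis
    unfolding * by (intro dfn dfn_opair3_eq)
qed

lemma dfn_opair4 [dfn]:
  "definable (\<lambda>M e. opair (e i) (opair (e l) (opair (e m) (e n))) \<in> elts (e k))"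
proof -
  have *: "opair w (opair x (opair y z)) \<in> elts r \<longleftrightarrow>
      (\<exists>p\<in>elts r. \<exists>u\<in>elts p. \<exists>q\<in>elts u. p = opair w q \<and> q = opair x (opair y z))" for w x y z r :: 'a
    using opair_right by blast
  show ?thesis
    unfolding * by (intro dfn dfn_opair3_eq)
qed

lemma dfn_Ord [dfn]: "definable (\<lambda>M e. Ord (e n))"
  unfolding Ord_def vtransitive_def by (intro dfn)

lemma dfn_is_bijection [dfn]: "definable (\<lambda>M e. is_bijection (e k) (e m) (e n))"
  unfolding is_bijection_alt by (intro dfn)

text \<open>As \<open>r\<close> may be multivalued and need not be contained in \<open>a \<times> b\<close>, this passes to subsets of
  \<open>a\<close> with the same \<open>r\<close>.\<close>

definition injects :: "'a::zfc_universe \<Rightarrow> 'a \<Rightarrow> 'a \<Rightarrow> bool" where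
  "injects r a b \<longleftrightarrow> (\<forall>x\<in>elts a. \<exists>y\<in>elts b. opair x y \<in> elts r) \<and>
    (\<forall>x\<in>elts a. \<forall>z\<in>elts a. \<forall>y\<in>elts b. opair x y \<in> elts r \<longrightarrow> opair z y \<in> elts r \<longrightarrow> x = z)"

lemma dfn_injects [dfn]: "definable (\<lambda>M e. injects (e k) (e m) (e n))"
  unfolding injects_def by (intro dfn)

lemma injects_iff: "(\<exists>r. injects r a b) \<longleftrightarrow> (\<exists>g. inj_on g (elts a) \<and> g ` elts a \<subseteq> elts b)"
proof
  assume "\<exists>r. injects r a b"
  then obtain r where r: "injects r a b" ..
  then obtain g where "\<And>x. x \<in> elts a \<Longrightarrow> g x \<in> elts b \<and> opair x (g x) \<in> elts r"
    unfolding injects_def by metis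
  then show "\<exists>g. inj_on g (elts a) \<and> g ` elts a \<subseteq> elts b"
    using r unfolding injects_def inj_on_def by (intro exI[of _ g]) (metis image_subsetI)
next
  assume "\<exists>g. inj_on g (elts a) \<and> g ` elts a \<subseteq> elts b"
  then obtain g where g: "inj_on g (elts a)" "g ` elts a \<subseteq> elts b" by blast
  obtain r where "\<forall>x y. opair x y \<in> elts r \<longleftrightarrow> x \<in> elts a \<and> y \<in> elts b \<and> y = g x"
    using set_relation2[of a b "\<lambda>x y. y = g x"] ..
  then have "injects r a b"
    using g unfolding injects_def inj_on_def by auto
  then show "\<exists>r. injects r a b" ..
qed

lemma injects_subset: "injects r a b \<Longrightarrow> elts c \<subseteq> elts a \<Longrightarrow> injects r c b"
  unfolding injects_def by blast

text \<open>One setting for \<open>j\<close>, \<open>i\<close> and \<open>h\<close>. Here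
  \<open>M\<close> is the domain and \<open>N\<close> the target; for an embedding of the universe
  into an inner model called \<open>M\<close>, facts about \<open>N\<close> therefore speak of that
  \<open>M\<close>.\<close>

locale transitive_embedding =
  fixes j :: "'a::zfc_universe \<Rightarrow> 'a" and M N :: "'a set"
  assumes transitive_M: "\<forall>x\<in>M. elts x \<subseteq> M" and transitive_N: "\<forall>x\<in>N. elts x \<subseteq> N"
    and elementary: "elementary_embedding j M N"
begin

lemma in_N [simp]: "x \<in> M \<Longrightarrow> j x \<in> N"
  using elementary unfolding elementary_embedding_def by blast

lemma elts_M: "x \<in> elts a \<Longrightarrow> a \<in> M \<Longrightarrow> x \<in> M"
  using transitive_M by blast

lemma elts_N: "x \<in> elts a \<Longrightarrow> a \<in> N \<Longrightarrow> x \<in> N"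
  using transitive_N by blast

lemma definable_iff:
  assumes "definable P" "range e \<subseteq> M"
  shows "P M e \<longleftrightarrow> P N (j \<circ> e)"
proof -
  obtain p where "\<forall>M e. (\<forall>x\<in>M. elts x \<subseteq> M) \<longrightarrow> range e \<subseteq> M \<longrightarrow> (sat M e p \<longleftrightarrow> P M e)"
    using assms(1) unfolding definable_def ..
  moreover have "range (j \<circ> e) \<subseteq> N"
    using assms(2) by auto
  ultimately show ?thesis
    using elementary assms(2) transitive_M transitive_N unfolding elementary_embedding_def by metis
qed

text \<open>Elementarity in the form used for every transfer: \<open>Q\<close> takes the class as an
  argument, so quantifiers over \<open>M\<close> become quantifiers over \<open>N\<close>. The
  versions with fewer parameters instantiate \<open>Q\<close> to ignore the last ones.\<close>

lemma preserves5:
  assumes "definable (\<lambda>M e. Q M (e 0) (e 1) (e 2) (e 3) (e 4))"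
    and "a \<in> M" "b \<in> M" "c \<in> M" "d \<in> M" "f \<in> M"
  shows "Q M a b c d f \<longleftrightarrow> Q N (j a) (j b) (j c) (j d) (j f)"
proof -
  define e where "e = (!) [a, b, c, d, f]"
  \<comment> \<open>Indexing past the end of the list is unspecified, so the value \<open>a\<close>
    is used from index 5 on to keep the assignment in \<open>M\<close>.\<close>
  define e' :: "nat \<Rightarrow> 'a" where "e' n = (if n < 5 then e n else a)" for n
  have "e' n \<in> M" for n
  proof (cases "n < 5")
    case True
    then have "e n \<in> set [a, b, c, d, f]"
      unfolding e_def by (intro nth_mem) simp
    with True show ?thesis
      using assms by (auto simp: e'_def)
  qed (use assms in \<open>simp add: e'_def\<close>)
  then have "range e' \<subseteq> M"
    by blast
  from definable_iff[OF assms(1) this] show ?thesis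
    by (simp add: e'_def e_def)
qed

lemma preserves4:
  assumes "definable (\<lambda>M e. Q M (e 0) (e 1) (e 2) (e 3))"
    and "a \<in> M" "b \<in> M" "c \<in> M" "d \<in> M"
  shows "Q M a b c d \<longleftrightarrow> Q N (j a) (j b) (j c) (j d)"
  using preserves5[where Q = "\<lambda>M a b c d _. Q M a b c d", OF assms(1)] assms by blast

lemma preserves3:
  assumes "definable (\<lambda>M e. Q M (e 0) (e 1) (e 2))"
    and "a \<in> M" "b \<in> M" "c \<in> M"
  shows "Q M a b c \<longleftrightarrow> Q N (j a) (j b) (j c)"
  using preserves5[where Q = "\<lambda>M a b c _ _. Q M a b c", OF assms(1)] assms by blast

lemma preserves2:
  assumes "definable (\<lambda>M e. Q M (e 0) (e 1))"
    and "a \<in> M" "b \<in> M"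
  shows "Q M a b \<longleftrightarrow> Q N (j a) (j b)"
  using preserves5[where Q = "\<lambda>M a b _ _ _. Q M a b", OF assms(1)] assms by blast

lemma preserves1:
  assumes "definable (\<lambda>M e. Q M (e 0))"
    and "a \<in> M"
  shows "Q M a \<longleftrightarrow> Q N (j a)"
  using preserves5[where Q = "\<lambda>M a _ _ _ _. Q M a", OF assms(1)] assms by blast

lemma embed_mem: "x \<in> M \<Longrightarrow> y \<in> M \<Longrightarrow> j x \<in> elts (j y) \<longleftrightarrow> x \<in> elts y"
  by (rule preserves2[where Q = "\<lambda>M x y. x \<in> elts y", symmetric]) (intro dfn)

lemma embed_opair:
  "x \<in> M \<Longrightarrow> y \<in> M \<Longrightarrow> r \<in> M \<Longrightarrow> opair (j x) (j y) \<in> elts (j r) \<longleftrightarrow> opair x y \<in> elts r"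
  by (rule preserves3[where Q = "\<lambda>M x y r. opair x y \<in> elts r", symmetric]) (intro dfn)

lemma embed_opair3:
  "x \<in> M \<Longrightarrow> y \<in> M \<Longrightarrow> z \<in> M \<Longrightarrow> r \<in> M \<Longrightarrow>
    opair (j x) (opair (j y) (j z)) \<in> elts (j r) \<longleftrightarrow> opair x (opair y z) \<in> elts r"
  by (rule preserves4[where Q = "\<lambda>M x y z r. opair x (opair y z) \<in> elts r", symmetric]) (intro dfn)

lemma embed_Ord: "x \<in> M \<Longrightarrow> Ord (j x) \<longleftrightarrow> Ord x"
  by (rule preserves1[where Q = "\<lambda>M x. Ord x", symmetric]) (intro dfn)

text \<open>All members of \<open>c\<close> are fixed and hence lie in \<open>j c\<close>; so
  \<open>j c\<close> in \<open>c\<close> would give \<open>j c\<close> in itself, and linearity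
  leaves only \<open>c\<close> in \<open>j c\<close>.\<close>

lemma critical_point_less:
  assumes "critical_point j c" "c \<in> M"
  shows "c \<in> elts (j c)"
proof -
  have c: "Ord c" "j c \<noteq> c" "\<And>a. a \<in> elts c \<Longrightarrow> j a = a"
    using assms(1) unfolding critical_point_def by auto
  have "a \<in> elts (j c)" if "a \<in> elts c" for a
    using embed_mem[of a c] that c(3) assms(2) elts_M by metis
  then have "j c \<notin> elts c"
    using not_mem_self by blast
  then show ?thesis
    using Ord_linear[of c "j c"] c(1,2) embed_Ord[OF assms(2)] by auto
qed

text \<open>If \<open>j a\<close> were in \<open>a\<close>, applying \<open>j\<close> would give a
  counterexample \<open>j a\<close> inside \<open>a\<close>, against induction.\<close>

lemma image_not_mem: "a \<in> M \<Longrightarrow> j a \<notin> elts a"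
proof (induction a rule: mem_induct)
  case (step a)
  show ?case
  proof
    assume "j a \<in> elts a"
    moreover from this have "j a \<in> M"
      using step.prems elts_M by blast
    ultimately show False
      using step embed_mem by blast
  qed
qed

end

section \<open>Critical points\<close>

text \<open>Let \<open>r\<close> inject \<open>\<kappa>\<close> into \<open>S\<close>. Then
  \<open>j r\<close> relates \<open>\<kappa>\<close>, a member of \<open>j \<kappa>\<close>, to some
  \<open>x\<close> in \<open>j S\<close>. As \<open>x\<close> is fixed, elementarity reflects this
  to some \<open>\<nu>\<close> below \<open>\<kappa>\<close> related to \<open>x\<close>; then
  \<open>\<nu>\<close> and \<open>\<kappa>\<close> collide under \<open>j r\<close>.\<close>

lemma no_injection:
  assumes "transitive_embedding j UNIV M" and crit: "critical_point j \<kappa>"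
    and fixed: "\<And>x. x \<in> elts (j S) \<Longrightarrow> j x = x"
  shows "\<not> (\<exists>g. inj_on g (elts \<kappa>) \<and> g ` elts \<kappa> \<subseteq> elts S)"
proof
  interpret transitive_embedding j UNIV M by fact
  assume "\<exists>g. inj_on g (elts \<kappa>) \<and> g ` elts \<kappa> \<subseteq> elts S"
  then obtain r where r: "injects r \<kappa> S"
    unfolding injects_iff[symmetric] ..
  have jr: "injects (j r) (j \<kappa>) (j S)"
    by (rule iffD1[OF preserves3[where Q = "\<lambda>M r k S. injects r k S"]]) (intro dfn, simp_all add: r)
  have \<kappa>: "\<kappa> \<in> elts (j \<kappa>)"
    using critical_point_less[OF crit] by simp
  then obtain x where x: "x \<in> elts (j S)" "opair \<kappa> x \<in> elts (j r)"
    using jr unfolding injects_def by blast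
  have "\<exists>\<nu>\<in>elts \<kappa>. opair \<nu> x \<in> elts r"
    by (rule iffD2[OF preserves3[where Q = "\<lambda>M k x r. \<exists>\<nu>\<in>elts k. opair \<nu> x \<in> elts r"]])
      (intro dfn, use \<kappa> x fixed[OF x(1)] in auto)
  then obtain \<nu> where \<nu>: "\<nu> \<in> elts \<kappa>" "opair \<nu> x \<in> elts r" by blast
  then have "opair \<nu> x \<in> elts (j r)"
    using embed_opair[of \<nu> x r] fixed[OF x(1)] crit unfolding critical_point_def by auto
  moreover have "\<nu> \<in> elts (j \<kappa>)"
    using \<nu>(1) \<kappa> embed_mem[of \<nu> \<kappa>] crit unfolding critical_point_def by auto
  ultimately have "\<nu> = \<kappa>"
    using jr x \<kappa> unfolding injects_def by blast
  with \<nu> not_mem_self show False by blast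
qed

text \<open>Otherwise elementarity would let every member of \<open>j \<kappa>\<close>, in
  particular \<open>\<kappa>\<close>, inject into \<open>j \<delta> = \<delta>\<close>, whose
  members are all fixed. This is the limit cardinal property of \<open>\<kappa>\<close>, phrased by
  injections so that it transfers directly.\<close>

lemma critical_point_limit:
  assumes emb: "transitive_embedding j UNIV M" and crit: "critical_point j \<kappa>"
    and \<delta>: "\<delta> \<in> elts \<kappa>"
  shows "\<exists>\<mu>\<in>elts \<kappa>. \<forall>r. \<not> injects r \<mu> \<delta>"
proof (rule ccontr)
  interpret transitive_embedding j UNIV M by fact
  assume "\<not> ?thesis"
  then have *: "\<forall>\<mu>\<in>elts \<kappa>. \<exists>r. injects r \<mu> \<delta>" by blast
  have "\<forall>\<mu>\<in>elts (j \<kappa>). \<exists>r\<in>M. injects r \<mu> (j \<delta>)"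
    by (rule iffD1[OF preserves2[where Q = "\<lambda>M k d. \<forall>\<mu>\<in>elts k. \<exists>r\<in>M. injects r \<mu> d"]])
      (intro dfn, use * in simp_all)
  moreover have fixed: "j x = x" if "x \<in> elts \<kappa>" for x
    using crit that unfolding critical_point_def by blast
  ultimately have "\<exists>r. injects r \<kappa> \<delta>"
    using critical_point_less[OF crit] \<delta> by force
  moreover have "j x = x" if "x \<in> elts (j \<delta>)" for x
  proof -
    have "Ord \<kappa>"
      using crit unfolding critical_point_def by blast
    then show ?thesis
      using fixed \<delta> that Ord_trans by metis
  qed
  ultimately show False
    using no_injection[OF emb crit, of \<delta>] unfolding injects_iff by blast
qed

text \<open>Since \<open>j a\<close> is contained in \<open>j \<theta> = \<theta>\<close>,
  membership in \<open>a\<close> and in \<open>j a\<close> need only be compared at fixed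
  points.\<close>

lemma critical_point_fixes_bounded:
  assumes "transitive_embedding j UNIV M" and crit: "critical_point j \<kappa>"
    and \<theta>: "\<theta> \<in> elts \<kappa>" and a: "elts a \<subseteq> elts \<theta>"
  shows "j a = a"
proof -
  interpret transitive_embedding j UNIV M by fact
  have fixed: "j x = x" if "x \<in> elts \<kappa>" for x
    using crit that unfolding critical_point_def by blast
  have fixed': "j x = x" if "x \<in> elts \<theta>" for x
    using crit fixed \<theta> that Ord_trans unfolding critical_point_def by blast
  have "elts (j a) \<subseteq> elts (j \<theta>)"
    by (rule iffD1[OF preserves2[where Q = "\<lambda>M a b. elts a \<subseteq> elts b"]]) (intro dfn, simp_all add: a)
  then have ja: "elts (j a) \<subseteq> elts \<theta>"
    using fixed[OF \<theta>] by simp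
  show ?thesis
  proof (rule elts_eqI)
    fix x
    show "x \<in> elts (j a) \<longleftrightarrow> x \<in> elts a"
    proof (cases "x \<in> elts \<theta>")
      case True
      then show ?thesis
        using embed_mem[of x a] fixed' by simp
    next
      case False
      then show ?thesis
        using a ja by blast
    qed
  qed
qed

text \<open>
  Ordering the pairs below first by a bound and then arbitrarily gives order type at most \<open>\<kappa>\<close>:
  otherwise \<open>\<kappa>\<close> would inject into the set of pairs below a single bound, all of whose members are
  fixed by \<open>j\<close>.
\<close>

lemma enumerate_bounded_pairs:
  fixes \<kappa> :: "'a::zfc_universe"
  assumes emb: "transitive_embedding j UNIV M" and crit: "critical_point j \<kappa>"
  shows "\<exists>C. (\<forall>\<xi> a. (\<exists>\<theta>\<in>elts \<kappa>. \<xi> \<in> elts \<theta> \<and> elts a \<subseteq> elts \<theta>) \<longrightarrow>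
      (\<exists>\<zeta>\<in>elts \<kappa>. opair \<zeta> (opair \<xi> a) \<in> elts C)) \<and>
    (\<forall>\<zeta> \<xi> a \<xi>' a'. opair \<zeta> (opair \<xi> a) \<in> elts C \<longrightarrow> opair \<zeta> (opair \<xi>' a') \<in> elts C \<longrightarrow>
      \<xi> = \<xi>' \<and> a = a')"
proof -
  interpret transitive_embedding j UNIV M by fact
  have Ord_\<kappa>: "Ord \<kappa>" and fixed: "\<And>x. x \<in> elts \<kappa> \<Longrightarrow> j x = x"
    using crit unfolding critical_point_def by auto
  define bounded where "bounded \<theta> p \<longleftrightarrow> (\<exists>\<xi> a. p = opair \<xi> a \<and> \<xi> \<in> elts \<theta> \<and> elts a \<subseteq> elts \<theta>)"
    for \<theta> p :: 'a
  define D where "D = {p. \<exists>\<theta>\<in>elts \<kappa>. bounded \<theta> p}"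
  define P where "P = vset {x. elts x \<subseteq> elts \<kappa>}"
  have P: "elts P = {x. elts x \<subseteq> elts \<kappa>}"
    unfolding P_def by (simp add: small_Pow)
  have sub: "elts \<theta> \<subseteq> elts \<kappa>" if "\<theta> \<in> elts \<kappa>" for \<theta>
    using Ord_trans[OF Ord_\<kappa> that] by blast
  have D_sub: "D \<subseteq> elts (vprod \<kappa> P)"
    unfolding D_def bounded_def using sub P by force
  then have small_D: "small D"
    by (rule small_subset[OF small_elts])
  \<comment> \<open>Some bound, not necessarily the least: it is enough that all pairs of level at
    most \<open>\<theta>\<close> are bounded by \<open>\<theta>\<close>.\<close>
  define level where "level p = (SOME \<theta>. \<theta> \<in> elts \<kappa> \<and> bounded \<theta> p)" for p
  have level: "level p \<in> elts \<kappa>" "bounded (level p) p" if "p \<in> D" for p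
    using that someI_ex[of "\<lambda>\<theta>. \<theta> \<in> elts \<kappa> \<and> bounded \<theta> p"] unfolding D_def level_def by blast+
  have Ord_level: "Ord (level p)" if "p \<in> D" for p
    using level(1)[OF that] Ord_in_Ord[OF Ord_\<kappa>] by blast
  obtain W :: "('a \<times> 'a) set" where W: "wf W \<and> trans W \<and> (\<forall>x y. x \<noteq> y \<longrightarrow> (x, y) \<in> W \<or> (y, x) \<in> W)"
    using well_order_type[where 'b = 'a] ..
  \<comment> \<open>Membership restricted to ordinals on the right, because the lexicographic order
    needs a transitive first component.\<close>
  define m where "m = {(x :: 'a, y). x \<in> elts y \<and> Ord y}"
  define R where "R = inv_image (m <*lex*> W) (\<lambda>p. (level p, p))"
  have "wf m"
    by (rule wf_subset[OF wf_mem]) (auto simp: m_def)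
  then have wf_R: "wf R"
    unfolding R_def using W by (intro wf_inv_image wf_lex_prod) auto
  have "trans m"
    unfolding m_def by (rule transI) (auto intro: Ord_trans)
  then have trans_R: "trans R"
    unfolding R_def using W by (intro trans_inv_image trans_lex_prod) auto
  have "(x, y) \<in> R \<or> (y, x) \<in> R" if "x \<in> D" "y \<in> D" "x \<noteq> y" for x y
    using Ord_linear[OF Ord_level[OF that(1)] Ord_level[OF that(2)]] Ord_level that W
    unfolding R_def m_def by auto
  from collapse_exists[OF wf_R trans_R this small_D] obtain c :: "'a \<Rightarrow> 'a" where c: "\<forall>x\<in>D. elts (c x) = c ` {y \<in> D. (y, x) \<in> R} \<and> Ord (c x)"
    and inj: "inj_on c D"
    by auto
  have not_\<kappa>: "c p \<noteq> \<kappa>" if p: "p \<in> D" for p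
  proof
    assume cp: "c p = \<kappa>"
    define \<theta> where "\<theta> = level p"
    have \<theta>: "\<theta> \<in> elts \<kappa>" "Ord \<theta>"
      unfolding \<theta>_def using p level Ord_level by auto
    define S where "S = vset {q. bounded \<theta> q}"
    have "{q. bounded \<theta> q} \<subseteq> D"
      unfolding D_def using \<theta> by blast
    then have S: "elts S = {q. bounded \<theta> q}"
      unfolding S_def by (intro elts_vset small_subset[OF small_D])
    \<comment> \<open>By elementarity the members of \<open>j S\<close> are pairs bounded by
      \<open>j \<theta> = \<theta>\<close>, so \<open>j\<close> fixes both components and therefore
      the pair.\<close>
    have "\<forall>p\<in>elts (j S). \<exists>\<xi>\<in>elts (j \<theta>). \<exists>a\<in>M. p = opair \<xi> a \<and> elts a \<subseteq> elts (j \<theta>)"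
      by (rule iffD1[OF preserves2[where
            Q = "\<lambda>M S l. \<forall>p\<in>elts S. \<exists>\<xi>\<in>elts l. \<exists>a\<in>M. p = opair \<xi> a \<and> elts a \<subseteq> elts l"]])
        (intro dfn, auto simp: S bounded_def)
    then have S_pairs: "\<exists>\<xi>\<in>elts \<theta>. \<exists>a. q = opair \<xi> a \<and> elts a \<subseteq> elts \<theta>" if "q \<in> elts (j S)" for q
      using that fixed[OF \<theta>(1)] by metis
    have "j q = q" if q_S: "q \<in> elts (j S)" for q
    proof -
      obtain \<xi> a where q: "\<xi> \<in> elts \<theta>" "q = opair \<xi> a" "elts a \<subseteq> elts \<theta>"
        using S_pairs[OF q_S] by blast
      have "j q = opair (j \<xi>) (j a)"
        by (rule iffD1[OF preserves3[where Q = "\<lambda>M q x a. q = opair x a"]]) (intro dfn, simp_all add: q(2))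
      moreover have "j \<xi> = \<xi>"
        using q(1) sub[OF \<theta>(1)] fixed by blast
      moreover have "j a = a"
        by (rule critical_point_fixes_bounded[OF emb crit \<theta>(1) q(3)])
      ultimately show "j q = q"
        using q by simp
    qed
    then have none: "\<not> (\<exists>g. inj_on g (elts \<kappa>) \<and> g ` elts \<kappa> \<subseteq> elts S)"
      by (rule no_injection[OF emb crit])
    let ?A = "{y \<in> D. (y, p) \<in> R}"
    have \<kappa>: "elts \<kappa> = c ` ?A"
      using c p cp by blast
    have "?A \<subseteq> elts S"
    proof
      fix y assume y: "y \<in> ?A"
      then have "level y \<in> elts \<theta> \<or> level y = \<theta>"
        unfolding R_def m_def \<theta>_def by auto
      then have "elts (level y) \<subseteq> elts \<theta>"
        using Ord_trans[OF \<theta>(2)] by blast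
      then show "y \<in> elts S"
        using level(2)[of y] y unfolding S bounded_def by blast
    qed
    then have "inv_into ?A c ` elts \<kappa> \<subseteq> elts S"
      unfolding \<kappa> by (intro image_subsetI) (use inv_into_into[of _ c ?A] in blast)
    moreover have "inj_on (inv_into ?A c) (elts \<kappa>)"
      unfolding \<kappa> by (rule inj_on_inv_into) simp
    ultimately show False
      using none by blast
  qed
  have c_\<kappa>: "c p \<in> elts \<kappa>" if p: "p \<in> D" for p
  proof -
    \<comment> \<open>A collapse value above \<open>\<kappa>\<close> would have
      \<open>\<kappa>\<close> as a member, and members of collapse values are collapse values
      themselves.\<close>
    have "\<kappa> \<notin> elts (c p)"
      using c p not_\<kappa> by auto
    then show ?thesis
      using Ord_linear[of "c p" \<kappa>] c p Ord_\<kappa> not_\<kappa>[OF p] by blast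
  qed
  \<comment> \<open>\<open>C\<close> is the inverse graph of the collapse, reading a code back as a
    pair.\<close>
  obtain C where C: "\<forall>\<zeta> \<xi> a. opair \<zeta> (opair \<xi> a) \<in> elts C \<longleftrightarrow> \<zeta> \<in> elts \<kappa> \<and> \<xi> \<in> elts \<kappa> \<and> a \<in> elts P \<and>
      opair \<xi> a \<in> D \<and> \<zeta> = c (opair \<xi> a)"
    using set_relation3[of \<kappa> \<kappa> P "\<lambda>\<zeta> \<xi> a. opair \<xi> a \<in> D \<and> \<zeta> = c (opair \<xi> a)"] ..
  have "\<exists>\<zeta>\<in>elts \<kappa>. opair \<zeta> (opair \<xi> a) \<in> elts C" if "\<exists>\<theta>\<in>elts \<kappa>. \<xi> \<in> elts \<theta> \<and> elts a \<subseteq> elts \<theta>" for \<xi> a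
  proof -
    have d: "opair \<xi> a \<in> D"
      using that unfolding D_def bounded_def by blast
    with D_sub have "\<xi> \<in> elts \<kappa> \<and> a \<in> elts P"
      using opair_in_vprod by blast
    with d c_\<kappa>[OF d] C show ?thesis by blast
  qed
  moreover have "\<xi> = \<xi>' \<and> a = a'"
    if "opair \<zeta> (opair \<xi> a) \<in> elts C" "opair \<zeta> (opair \<xi>' a') \<in> elts C" for \<zeta> \<xi> a \<xi>' a'
  proof -
    have "c (opair \<xi> a) = c (opair \<xi>' a')" "opair \<xi> a \<in> D" "opair \<xi>' a' \<in> D"
      using that C by auto
    then have "opair \<xi> a = opair \<xi>' a'"
      using inj by (auto dest: inj_onD)
    then show ?thesis by simp
  qed
  ultimately show ?thesis
    by (intro exI[of _ C]) blast
qed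

text \<open>
  \<open>E\<close> codes injections \<open>e\<^sub>\<alpha>\<close> of \<open>\<alpha> < \<kappa>\<^sup>+\<close> into \<open>\<kappa>\<close>, and \<open>G\<close> codes
  \<open>g(\<alpha>, \<xi>, \<beta>) = otp {\<beta>' < \<beta>. e\<^sub>\<alpha>(\<beta>') < \<xi>}\<close>, so that \<open>\<xi> \<mapsto> g(\<alpha>, \<xi>, \<alpha>)\<close> is the \<open>\<alpha>\<close>-th canonical
  function on \<open>\<kappa>\<close>.
\<close>

lemma canonical_functions:
  fixes \<kappa> :: "'a::zfc_universe"
  assumes Ord_\<kappa>: "Ord \<kappa>"
    and limit: "\<forall>\<delta>\<in>elts \<kappa>. \<exists>\<mu>\<in>elts \<kappa>. \<forall>r. \<not> injects r \<mu> \<delta>"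
    and l_def: "l = card_succ \<kappa>"
  obtains E G where
    "\<And>\<alpha> \<beta>. \<alpha> \<in> elts l \<Longrightarrow> \<beta> \<in> elts \<alpha> \<Longrightarrow> \<exists>\<nu>\<in>elts \<kappa>. opair \<alpha> (opair \<beta> \<nu>) \<in> elts E"
    "\<And>\<alpha> \<beta> \<beta>' \<nu>. opair \<alpha> (opair \<beta> \<nu>) \<in> elts E \<Longrightarrow> opair \<alpha> (opair \<beta>' \<nu>) \<in> elts E \<Longrightarrow> \<beta> = \<beta>'"
    "\<And>\<alpha> \<xi> \<beta>. \<alpha> \<in> elts l \<Longrightarrow> \<xi> \<in> elts \<kappa> \<Longrightarrow> \<beta> \<in> elts \<alpha> \<or> \<beta> = \<alpha> \<Longrightarrow>
      \<exists>\<eta>. opair \<alpha> (opair \<xi> (opair \<beta> \<eta>)) \<in> elts G \<and> (\<forall>z. z \<in> elts \<eta> \<longleftrightarrow>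
        (\<exists>\<beta>'\<in>elts \<beta>. \<exists>\<nu>\<in>elts \<xi>. opair \<alpha> (opair \<beta>' \<nu>) \<in> elts E \<and>
          opair \<alpha> (opair \<xi> (opair \<beta>' z)) \<in> elts G))"
    "\<And>\<alpha> \<xi> \<beta> \<eta> \<eta>'. opair \<alpha> (opair \<xi> (opair \<beta> \<eta>)) \<in> elts G \<Longrightarrow>
      opair \<alpha> (opair \<xi> (opair \<beta> \<eta>')) \<in> elts G \<Longrightarrow> \<eta> = \<eta>'"
    "\<And>\<xi>. \<xi> \<in> elts \<kappa> \<Longrightarrow> \<exists>\<mu>\<in>elts \<kappa>. \<forall>\<alpha>\<in>elts l. \<forall>\<eta>.
      opair \<alpha> (opair \<xi> (opair \<alpha> \<eta>)) \<in> elts G \<longrightarrow> \<eta> \<in> elts \<mu>"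
proof -
  have Ord_l: "Ord l"
    using card_succ[OF Ord_\<kappa>] l_def by simp
  have "\<exists>e. inj_on e (elts \<alpha>) \<and> e ` elts \<alpha> \<subseteq> elts \<kappa>" if "\<alpha> \<in> elts l" for \<alpha>
    using card_succ(3)[OF Ord_\<kappa>] that l_def by blast
  then obtain e where e: "\<And>\<alpha>. \<alpha> \<in> elts l \<Longrightarrow> inj_on (e \<alpha>) (elts \<alpha>)"
      "\<And>\<alpha>. \<alpha> \<in> elts l \<Longrightarrow> e \<alpha> ` elts \<alpha> \<subseteq> elts \<kappa>"
    by metis
  define F where "F \<alpha> \<xi> f \<beta> = vset (f ` {\<beta>' \<in> elts \<beta>. e \<alpha> \<beta>' \<in> elts \<xi>})" for \<alpha> \<xi> \<beta> and f :: "'a \<Rightarrow> 'a"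
  define g where "g \<alpha> \<xi> = wfrec {(x, y). x \<in> elts y} (F \<alpha> \<xi>)" for \<alpha> \<xi>
  have g: "elts (g \<alpha> \<xi> \<beta>) = g \<alpha> \<xi> ` {\<beta>' \<in> elts \<beta>. e \<alpha> \<beta>' \<in> elts \<xi>}" for \<alpha> \<xi> \<beta>
  proof -
    have "adm_wf {(x, y). x \<in> elts y} (F \<alpha> \<xi>)"
      unfolding adm_wf_def F_def by (auto intro!: arg_cong[where f = vset] image_cong)
    then have "g \<alpha> \<xi> \<beta> = F \<alpha> \<xi> (g \<alpha> \<xi>) \<beta>"
      unfolding g_def by (subst wfrec_fixpoint[OF wf_mem]) auto
    moreover have "small {\<beta>' \<in> elts \<beta>. e \<alpha> \<beta>' \<in> elts \<xi>}"
      by (rule small_subset[OF small_elts]) auto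
    ultimately show ?thesis
      unfolding F_def by simp
  qed
  have trans_g: "vtransitive (g \<alpha> \<xi> \<beta>)" if "Ord \<beta>" for \<alpha> \<xi> \<beta>
    unfolding vtransitive_def
  proof (intro ballI subsetI)
    fix x y assume "x \<in> elts (g \<alpha> \<xi> \<beta>)" "y \<in> elts x"
    then obtain \<beta>' \<beta>'' where "\<beta>' \<in> elts \<beta>" "\<beta>'' \<in> elts \<beta>'" "e \<alpha> \<beta>'' \<in> elts \<xi>" "y = g \<alpha> \<xi> \<beta>''"
      unfolding g by (auto simp: g)
    then show "y \<in> elts (g \<alpha> \<xi> \<beta>)"
      unfolding g using Ord_trans[OF that] by blast
  qed
  have Ord_g: "Ord (g \<alpha> \<xi> \<beta>)" if "Ord \<beta>" for \<alpha> \<xi> \<beta>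
    unfolding Ord_def g[of \<alpha> \<xi> \<beta>] using trans_g[OF that] trans_g Ord_in_Ord[OF that] by auto
  \<comment> \<open>The bound depends on \<open>\<xi>\<close> alone: if
    \<open>g \<alpha> \<xi> \<beta>\<close> reached \<open>\<mu>\<close>, preimages under the
    collapse followed by \<open>e \<alpha>\<close> would inject \<open>\<mu>\<close> into
    \<open>\<xi>\<close>, which \<open>\<mu>\<close> was chosen to exclude.\<close>
  have bound: "\<exists>\<mu>\<in>elts \<kappa>. \<forall>\<alpha>\<in>elts l. \<forall>\<beta>. \<beta> \<in> elts \<alpha> \<or> \<beta> = \<alpha> \<longrightarrow> g \<alpha> \<xi> \<beta> \<in> elts \<mu>" if \<xi>: "\<xi> \<in> elts \<kappa>" for \<xi>
  proof -
    obtain \<mu> where \<mu>: "\<mu> \<in> elts \<kappa>" "\<forall>r. \<not> injects r \<mu> \<xi>"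
      using limit \<xi> by blast
    have "g \<alpha> \<xi> \<beta> \<in> elts \<mu>" if \<alpha>: "\<alpha> \<in> elts l" and \<beta>: "\<beta> \<in> elts \<alpha> \<or> \<beta> = \<alpha>" for \<alpha> \<beta>
    proof (rule ccontr)
      assume n: "g \<alpha> \<xi> \<beta> \<notin> elts \<mu>"
      have "Ord \<alpha>"
        using Ord_in_Ord[OF Ord_l \<alpha>] .
      then have "Ord \<beta>" and sub: "elts \<beta> \<subseteq> elts \<alpha>"
        using \<beta> Ord_in_Ord Ord_trans by blast+
      have sub': "elts \<mu> \<subseteq> elts (g \<alpha> \<xi> \<beta>)"
        using Ord_linear[OF Ord_in_Ord[OF Ord_\<kappa> \<mu>(1)] Ord_g[OF \<open>Ord \<beta>\<close>]] n
          Ord_trans[OF Ord_g[OF \<open>Ord \<beta>\<close>]] by blast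
      let ?A = "{\<beta>' \<in> elts \<beta>. e \<alpha> \<beta>' \<in> elts \<xi>}"
      let ?h = "inv_into ?A (g \<alpha> \<xi>)"
      have "elts \<mu> \<subseteq> g \<alpha> \<xi> ` ?A"
        using sub' unfolding g[of \<alpha> \<xi> \<beta>] .
      then have h: "inj_on ?h (elts \<mu>)" "?h ` elts \<mu> \<subseteq> ?A"
        by (rule inj_on_inv_into, intro image_subsetI inv_into_into) blast
      have "inj_on (e \<alpha>) (?h ` elts \<mu>)"
        by (rule inj_on_subset[OF e(1)[OF \<alpha>]]) (use h(2) sub in blast)
      then have "inj_on (e \<alpha> \<circ> ?h) (elts \<mu>)"
        by (rule comp_inj_on[OF h(1)])
      moreover have "(e \<alpha> \<circ> ?h) ` elts \<mu> \<subseteq> elts \<xi>"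
        using h(2) by auto
      ultimately have "\<exists>r. injects r \<mu> \<xi>"
        unfolding injects_iff by blast
      with \<mu>(2) show False by blast
    qed
    with \<mu>(1) show ?thesis by blast
  qed
  obtain E where E: "\<forall>\<alpha> \<beta> \<nu>. opair \<alpha> (opair \<beta> \<nu>) \<in> elts E \<longleftrightarrow>
      \<alpha> \<in> elts l \<and> \<beta> \<in> elts l \<and> \<nu> \<in> elts \<kappa> \<and> \<beta> \<in> elts \<alpha> \<and> \<nu> = e \<alpha> \<beta>"
    using set_relation3[of l l \<kappa> "\<lambda>\<alpha> \<beta> \<nu>. \<beta> \<in> elts \<alpha> \<and> \<nu> = e \<alpha> \<beta>"] ..
  have E: "opair \<alpha> (opair \<beta> \<nu>) \<in> elts E \<longleftrightarrow> \<alpha> \<in> elts l \<and> \<beta> \<in> elts \<alpha> \<and> \<nu> = e \<alpha> \<beta>" for \<alpha> \<beta> \<nu>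
    using E e(2) Ord_trans[OF Ord_l] by blast
  obtain G where G: "\<forall>\<alpha> \<xi> \<beta> \<eta>. opair \<alpha> (opair \<xi> (opair \<beta> \<eta>)) \<in> elts G \<longleftrightarrow>
      \<alpha> \<in> elts l \<and> \<xi> \<in> elts \<kappa> \<and> \<beta> \<in> elts l \<and> \<eta> \<in> elts \<kappa> \<and> (\<beta> \<in> elts \<alpha> \<or> \<beta> = \<alpha>) \<and> \<eta> = g \<alpha> \<xi> \<beta>"
    using set_relation4[of l \<kappa> l \<kappa> "\<lambda>\<alpha> \<xi> \<beta> \<eta>. (\<beta> \<in> elts \<alpha> \<or> \<beta> = \<alpha>) \<and> \<eta> = g \<alpha> \<xi> \<beta>"] ..
  \<comment> \<open>Because of this, confining the last coordinate of \<open>G\<close> to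
    \<open>\<kappa>\<close> loses no value of \<open>g\<close>.\<close>
  have g_\<kappa>: "g \<alpha> \<xi> \<beta> \<in> elts \<kappa>" if "\<alpha> \<in> elts l" "\<xi> \<in> elts \<kappa>" "\<beta> \<in> elts \<alpha> \<or> \<beta> = \<alpha>" for \<alpha> \<xi> \<beta>
    using bound[OF that(2)] that Ord_trans[OF Ord_\<kappa>] by blast
  have G: "opair \<alpha> (opair \<xi> (opair \<beta> \<eta>)) \<in> elts G \<longleftrightarrow>
      \<alpha> \<in> elts l \<and> \<xi> \<in> elts \<kappa> \<and> (\<beta> \<in> elts \<alpha> \<or> \<beta> = \<alpha>) \<and> \<eta> = g \<alpha> \<xi> \<beta>" for \<alpha> \<xi> \<beta> \<eta>
    using G g_\<kappa> Ord_trans[OF Ord_l] by blast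
  show thesis
  proof
    show "\<exists>\<nu>\<in>elts \<kappa>. opair \<alpha> (opair \<beta> \<nu>) \<in> elts E" if "\<alpha> \<in> elts l" "\<beta> \<in> elts \<alpha>" for \<alpha> \<beta>
      unfolding E using that e(2) by blast
    show "\<beta> = \<beta>'" if "opair \<alpha> (opair \<beta> \<nu>) \<in> elts E" "opair \<alpha> (opair \<beta>' \<nu>) \<in> elts E" for \<alpha> \<beta> \<beta>' \<nu>
      using that e(1)[of \<alpha>] unfolding E by (auto dest: inj_onD)
    show "\<exists>\<eta>. opair \<alpha> (opair \<xi> (opair \<beta> \<eta>)) \<in> elts G \<and> (\<forall>z. z \<in> elts \<eta> \<longleftrightarrow>
        (\<exists>\<beta>'\<in>elts \<beta>. \<exists>\<nu>\<in>elts \<xi>. opair \<alpha> (opair \<beta>' \<nu>) \<in> elts E \<and>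
          opair \<alpha> (opair \<xi> (opair \<beta>' z)) \<in> elts G))"
      if \<alpha>: "\<alpha> \<in> elts l" and "\<xi> \<in> elts \<kappa>" and \<beta>: "\<beta> \<in> elts \<alpha> \<or> \<beta> = \<alpha>" for \<alpha> \<xi> \<beta>
    proof -
      have "\<beta>' \<in> elts \<alpha>" if "\<beta>' \<in> elts \<beta>" for \<beta>'
        using \<beta> that Ord_trans[OF Ord_in_Ord[OF Ord_l \<alpha>]] by blast
      then show ?thesis
        unfolding E G using that by (intro exI[of _ "g \<alpha> \<xi> \<beta>"]) (auto simp: g[of \<alpha> \<xi> \<beta>])
    qed
    show "\<eta> = \<eta>'" if "opair \<alpha> (opair \<xi> (opair \<beta> \<eta>)) \<in> elts G"
      "opair \<alpha> (opair \<xi> (opair \<beta> \<eta>')) \<in> elts G" for \<alpha> \<xi> \<beta> \<eta> \<eta>'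
      using that unfolding G by simp
    show "\<exists>\<mu>\<in>elts \<kappa>. \<forall>\<alpha>\<in>elts l. \<forall>\<eta>. opair \<alpha> (opair \<xi> (opair \<alpha> \<eta>)) \<in> elts G \<longrightarrow> \<eta> \<in> elts \<mu>"
      if "\<xi> \<in> elts \<kappa>" for \<xi>
      unfolding G using bound[OF that] by blast
  qed
qed

section \<open>The ultrafilter\<close>

theorem theorem1p2:
  fixes \<kappa> :: "'a::zfc_universe"
  assumes "non_Galvin_cardinal \<kappa>"
  shows "\<exists>U. complete_ultrafilter_over \<kappa> U \<and> \<not> Gal \<kappa> U \<kappa> (card_succ \<kappa>) \<and>
             (two_power \<kappa> = card_succ \<kappa> \<longrightarrow> non_Galvin_ultrafilter \<kappa> U)"
proof -

  \<comment> \<open>The embeddings and their critical points\<close>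
  define l where "l = card_succ \<kappa>"
  obtain M N j i h A where
    inner: "inner_model M" "inner_model N" and
    emb: "elementary_embedding j UNIV M" "elementary_embedding i UNIV N" "elementary_embedding h N M"
    and hi: "h \<circ> i = j"
    and crit_j: "critical_point j \<kappa>" and crit_h: "critical_point h (i \<kappa>)"
    and A: "A \<in> M" "i ` elts l \<subseteq> elts A" "card_in M A \<^bold>\<in> i \<kappa>"
    using assms unfolding non_Galvin_cardinal_def l_def by metis
  have transitive: "\<forall>x\<in>M. elts x \<subseteq> M" "\<forall>x\<in>N. elts x \<subseteq> N"
    using inner unfolding inner_model_def by auto
  interpret J: transitive_embedding j UNIV M
    by unfold_locales (use emb transitive in auto)
  interpret I: transitive_embedding i UNIV N
    by unfold_locales (use emb transitive in auto)
  interpret H: transitive_embedding h N M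
    by unfold_locales (use emb transitive in auto)
  have embJ: "transitive_embedding j UNIV M" ..
  have hi: "h (i x) = j x" for x
    using hi by (metis comp_apply)
  have i_N [simp]: "i x \<in> N" and j_M [simp]: "j x \<in> M" for x
    by simp_all
  have Ord_\<kappa>: "Ord \<kappa>" and j_fixed: "\<And>x. x \<in> elts \<kappa> \<Longrightarrow> j x = x"
    using crit_j unfolding critical_point_def by auto
  have h_fixed: "\<And>x. x \<in> elts (i \<kappa>) \<Longrightarrow> h x = x"
    using crit_h unfolding critical_point_def by auto
  have Ord_M: "x \<in> M" if "Ord x" for x
    using inner that unfolding inner_model_def by blast
  have \<kappa>_j: "\<kappa> \<in> elts (j \<kappa>)"
    using J.critical_point_less[OF crit_j] by simp
  have i\<kappa>_j: "i \<kappa> \<in> elts (j \<kappa>)"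
    using H.critical_point_less[OF crit_h] by (simp add: hi)
  have i\<kappa>_not: "i \<kappa> \<notin> elts \<kappa>"
    using I.image_not_mem by simp
  have Ord_i\<kappa>: "Ord (i \<kappa>)"
    using I.embed_Ord[of \<kappa>] Ord_\<kappa> by simp
  have Ord_l: "Ord l" and \<kappa>_l: "\<kappa> \<in> elts l"
    using card_succ[OF Ord_\<kappa>] l_def by auto
  have Ord_il: "Ord (i l)"
    using I.embed_Ord[of l] Ord_l by simp
  have Ord_j\<kappa>: "Ord (j \<kappa>)"
    using J.embed_Ord[of \<kappa>] Ord_\<kappa> by simp

  \<comment> \<open>The cardinality of the covering set in \<open>M\<close>\<close>
  define \<delta> where "\<delta> = card_in M A"
  \<comment> \<open>Transfers the existence of ordinal enumerations to \<open>M\<close>, so that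
    \<open>card_in M A\<close> denotes. The sentence has no parameter; \<open>\<kappa>\<close> only
    fills the argument place.\<close>
  have "\<forall>a\<in>M. \<exists>d\<in>M. Ord d \<and> (\<exists>f\<in>M. is_bijection f a d)"
    by (rule iffD1[OF J.preserves1[where a = \<kappa> and
            Q = "\<lambda>M x. \<forall>a\<in>M. \<exists>d\<in>M. Ord d \<and> (\<exists>f\<in>M. is_bijection f a d)"]])
      (intro dfn, simp_all add: bijection_Ord_exists)
  then obtain d f where "Ord d" "f \<in> M" "is_bijection f A d"
    using A(1) by blast
  then obtain B where B: "B \<in> M" "is_bijection B A \<delta>"
    using card_in(2)[of d f M A] unfolding \<delta>_def by blast
  have \<delta>: "\<delta> \<in> elts (i \<kappa>)"
    using A(3) unfolding \<delta>_def mem_iff .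
  have \<delta>_M: "\<delta> \<in> M" and \<delta>_N: "\<delta> \<in> N"
    using \<delta> i\<kappa>_j J.elts_N I.elts_N i_N j_M by blast+

  \<comment> \<open>Canonical functions and codes for bounded pairs\<close>
  have limit: "\<forall>\<delta>\<in>elts \<kappa>. \<exists>\<mu>\<in>elts \<kappa>. \<forall>r. \<not> injects r \<mu> \<delta>"
    using critical_point_limit[OF embJ crit_j] by blast
  obtain E G where
    E_total: "\<And>\<alpha> \<beta>. \<alpha> \<in> elts l \<Longrightarrow> \<beta> \<in> elts \<alpha> \<Longrightarrow> \<exists>\<nu>\<in>elts \<kappa>. opair \<alpha> (opair \<beta> \<nu>) \<in> elts E"
    and E_inj: "\<And>\<alpha> \<beta> \<beta>' \<nu>. opair \<alpha> (opair \<beta> \<nu>) \<in> elts E \<Longrightarrow> opair \<alpha> (opair \<beta>' \<nu>) \<in> elts E \<Longrightarrow> \<beta> = \<beta>'"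
    and G_rec: "\<And>\<alpha> \<xi> \<beta>. \<alpha> \<in> elts l \<Longrightarrow> \<xi> \<in> elts \<kappa> \<Longrightarrow> \<beta> \<in> elts \<alpha> \<or> \<beta> = \<alpha> \<Longrightarrow>
      \<exists>\<eta>. opair \<alpha> (opair \<xi> (opair \<beta> \<eta>)) \<in> elts G \<and> (\<forall>z. z \<in> elts \<eta> \<longleftrightarrow>
        (\<exists>\<beta>'\<in>elts \<beta>. \<exists>\<nu>\<in>elts \<xi>. opair \<alpha> (opair \<beta>' \<nu>) \<in> elts E \<and>
          opair \<alpha> (opair \<xi> (opair \<beta>' z)) \<in> elts G))"
    and G_fun: "\<And>\<alpha> \<xi> \<beta> \<eta> \<eta>'. opair \<alpha> (opair \<xi> (opair \<beta> \<eta>)) \<in> elts G \<Longrightarrow>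
      opair \<alpha> (opair \<xi> (opair \<beta> \<eta>')) \<in> elts G \<Longrightarrow> \<eta> = \<eta>'"
    and G_bound: "\<And>\<xi>. \<xi> \<in> elts \<kappa> \<Longrightarrow> \<exists>\<mu>\<in>elts \<kappa>. \<forall>\<alpha>\<in>elts l. \<forall>\<eta>.
      opair \<alpha> (opair \<xi> (opair \<alpha> \<eta>)) \<in> elts G \<longrightarrow> \<eta> \<in> elts \<mu>"
  proof (rule canonical_functions[OF Ord_\<kappa> limit l_def], goal_cases)
    case (1 E G)
    show ?case
      by (rule 1(1)) (fact 1(2-))+
  qed
  obtain C where
    C_total: "\<forall>\<xi> a. (\<exists>\<theta>\<in>elts \<kappa>. \<xi> \<in> elts \<theta> \<and> elts a \<subseteq> elts \<theta>) \<longrightarrow>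
      (\<exists>\<zeta>\<in>elts \<kappa>. opair \<zeta> (opair \<xi> a) \<in> elts C)"
    and C_inj: "\<forall>\<zeta> \<xi> a \<xi>' a'. opair \<zeta> (opair \<xi> a) \<in> elts C \<longrightarrow> opair \<zeta> (opair \<xi>' a') \<in> elts C \<longrightarrow>
      \<xi> = \<xi>' \<and> a = a'"
    using enumerate_bounded_pairs[OF embJ crit_j] by blast

  \<comment> \<open>Transfer along \<open>i\<close> and \<open>j\<close>\<close>
  have iE_total: "\<forall>\<alpha>\<in>elts (i l). \<forall>\<beta>\<in>elts \<alpha>. \<exists>\<nu>\<in>elts (i \<kappa>). opair \<alpha> (opair \<beta> \<nu>) \<in> elts (i E)"
    by (rule iffD1[OF I.preserves3[where
            Q = "\<lambda>M k l E. \<forall>\<alpha>\<in>elts l. \<forall>\<beta>\<in>elts \<alpha>. \<exists>\<nu>\<in>elts k. opair \<alpha> (opair \<beta> \<nu>) \<in> elts E"]])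
      (intro dfn, simp_all add: E_total)
  have jE_inj: "\<forall>\<alpha>\<in>M. \<forall>\<beta>\<in>M. \<forall>\<beta>'\<in>M. \<forall>\<nu>\<in>M. opair \<alpha> (opair \<beta> \<nu>) \<in> elts (j E) \<longrightarrow>
      opair \<alpha> (opair \<beta>' \<nu>) \<in> elts (j E) \<longrightarrow> \<beta> = \<beta>'"
    by (rule iffD1[OF J.preserves1[where Q = "\<lambda>M E. \<forall>\<alpha>\<in>M. \<forall>\<beta>\<in>M. \<forall>\<beta>'\<in>M. \<forall>\<nu>\<in>M.
            opair \<alpha> (opair \<beta> \<nu>) \<in> elts E \<longrightarrow> opair \<alpha> (opair \<beta>' \<nu>) \<in> elts E \<longrightarrow> \<beta> = \<beta>'"]])
      (intro dfn, simp, use E_inj in blast)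
  \<comment> \<open>After transfer \<open>\<xi>\<close> ranges over \<open>j \<kappa>\<close> and
    may be taken to be \<open>i \<kappa>\<close>.\<close>
  have jG_rec: "\<forall>\<alpha>\<in>elts (j l). \<forall>\<xi>\<in>elts (j \<kappa>). \<forall>\<beta>\<in>M. \<beta> \<in> elts \<alpha> \<or> \<beta> = \<alpha> \<longrightarrow>
      (\<exists>\<eta>\<in>M. opair \<alpha> (opair \<xi> (opair \<beta> \<eta>)) \<in> elts (j G) \<and> (\<forall>z\<in>M. z \<in> elts \<eta> \<longleftrightarrow>
        (\<exists>\<beta>'\<in>elts \<beta>. \<exists>\<nu>\<in>elts \<xi>. opair \<alpha> (opair \<beta>' \<nu>) \<in> elts (j E) \<and>
          opair \<alpha> (opair \<xi> (opair \<beta>' z)) \<in> elts (j G))))"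
    by (rule iffD1[OF J.preserves4[where Q = "\<lambda>M k l E G. \<forall>\<alpha>\<in>elts l. \<forall>\<xi>\<in>elts k. \<forall>\<beta>\<in>M.
          \<beta> \<in> elts \<alpha> \<or> \<beta> = \<alpha> \<longrightarrow>
            (\<exists>\<eta>\<in>M. opair \<alpha> (opair \<xi> (opair \<beta> \<eta>)) \<in> elts G \<and> (\<forall>z\<in>M. z \<in> elts \<eta> \<longleftrightarrow>
              (\<exists>\<beta>'\<in>elts \<beta>. \<exists>\<nu>\<in>elts \<xi>. opair \<alpha> (opair \<beta>' \<nu>) \<in> elts E \<and>
                opair \<alpha> (opair \<xi> (opair \<beta>' z)) \<in> elts G)))"]])
      (intro dfn, simp, simp, simp, simp, simp only: ball_UNIV bex_UNIV, use G_rec in blast)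
  have jG_fun: "\<forall>\<alpha>\<in>M. \<forall>\<xi>\<in>M. \<forall>\<beta>\<in>M. \<forall>\<eta>\<in>M. \<forall>\<eta>'\<in>M. opair \<alpha> (opair \<xi> (opair \<beta> \<eta>)) \<in> elts (j G) \<longrightarrow>
      opair \<alpha> (opair \<xi> (opair \<beta> \<eta>')) \<in> elts (j G) \<longrightarrow> \<eta> = \<eta>'"
    by (rule iffD1[OF J.preserves1[where Q = "\<lambda>M G. \<forall>\<alpha>\<in>M. \<forall>\<xi>\<in>M. \<forall>\<beta>\<in>M. \<forall>\<eta>\<in>M. \<forall>\<eta>'\<in>M.
            opair \<alpha> (opair \<xi> (opair \<beta> \<eta>)) \<in> elts G \<longrightarrow>
            opair \<alpha> (opair \<xi> (opair \<beta> \<eta>')) \<in> elts G \<longrightarrow> \<eta> = \<eta>'"]])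
      (intro dfn, simp, use G_fun in blast)
  have jG_bound: "\<forall>\<xi>\<in>elts (j \<kappa>). \<exists>\<mu>\<in>elts (j \<kappa>). \<forall>\<alpha>\<in>elts (j l). \<forall>\<eta>\<in>M.
      opair \<alpha> (opair \<xi> (opair \<alpha> \<eta>)) \<in> elts (j G) \<longrightarrow> \<eta> \<in> elts \<mu>"
    by (rule iffD1[OF J.preserves3[where Q = "\<lambda>M k l G. \<forall>\<xi>\<in>elts k. \<exists>\<mu>\<in>elts k. \<forall>\<alpha>\<in>elts l. \<forall>\<eta>\<in>M.
            opair \<alpha> (opair \<xi> (opair \<alpha> \<eta>)) \<in> elts G \<longrightarrow> \<eta> \<in> elts \<mu>"]])
      (intro dfn, simp_all add: G_bound)
  have jC_total: "\<forall>\<xi>\<in>M. \<forall>a\<in>M. (\<exists>\<theta>\<in>elts (j \<kappa>). \<xi> \<in> elts \<theta> \<and> elts a \<subseteq> elts \<theta>) \<longrightarrow>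
      (\<exists>\<zeta>\<in>elts (j \<kappa>). opair \<zeta> (opair \<xi> a) \<in> elts (j C))"
    by (rule iffD1[OF J.preserves2[where Q = "\<lambda>M k C. \<forall>\<xi>\<in>M. \<forall>a\<in>M.
            (\<exists>\<theta>\<in>elts k. \<xi> \<in> elts \<theta> \<and> elts a \<subseteq> elts \<theta>) \<longrightarrow>
            (\<exists>\<zeta>\<in>elts k. opair \<zeta> (opair \<xi> a) \<in> elts C)"]])
      (intro dfn, simp, simp, use C_total in blast)
  have jC_inj: "\<forall>\<zeta>\<in>M. \<forall>\<xi>\<in>M. \<forall>a\<in>M. \<forall>\<xi>'\<in>M. \<forall>a'\<in>M. opair \<zeta> (opair \<xi> a) \<in> elts (j C) \<longrightarrow>
      opair \<zeta> (opair \<xi>' a') \<in> elts (j C) \<longrightarrow> \<xi> = \<xi>' \<and> a = a'"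
    by (rule iffD1[OF J.preserves1[where Q = "\<lambda>M C. \<forall>\<zeta>\<in>M. \<forall>\<xi>\<in>M. \<forall>a\<in>M. \<forall>\<xi>'\<in>M. \<forall>a'\<in>M.
            opair \<zeta> (opair \<xi> a) \<in> elts C \<longrightarrow> opair \<zeta> (opair \<xi>' a') \<in> elts C \<longrightarrow> \<xi> = \<xi>' \<and> a = a'"]])
      (intro dfn, simp, use C_inj in blast)

  \<comment> \<open>The transferred canonical functions at \<open>i \<kappa>\<close>\<close>
  have canonical: "opair (h \<gamma>) (opair (i \<kappa>) (opair (h \<beta>) \<beta>)) \<in> elts (j G)"
    if \<gamma>: "\<gamma> \<in> elts (i l)" and "\<beta> \<in> elts \<gamma> \<or> \<beta> = \<gamma>" for \<gamma> \<beta>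
    using that(2)
  proof (induction \<beta> rule: mem_induct)
    case (step \<beta>)
    have \<gamma>_N: "\<gamma> \<in> N" and Ord_\<gamma>: "Ord \<gamma>"
      using \<gamma> I.elts_N i_N Ord_in_Ord[OF Ord_il] by blast+
    have \<beta>_N: "\<beta> \<in> N"
      using step.prems \<gamma>_N I.elts_N by blast
    have Ord_\<beta>: "Ord \<beta>"
      using step.prems Ord_\<gamma> Ord_in_Ord by blast
    have h\<gamma>: "h \<gamma> \<in> elts (j l)"
      using H.embed_mem[OF \<gamma>_N i_N[of l]] \<gamma> by (simp add: hi)
    have below: "\<beta>' \<in> elts \<gamma>" if "\<beta>' \<in> elts \<beta>" for \<beta>'
      using step.prems that Ord_trans[OF Ord_\<gamma>] by blast
    have "h \<beta> \<in> elts (h \<gamma>) \<or> h \<beta> = h \<gamma>"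
      using step.prems H.embed_mem[OF \<beta>_N \<gamma>_N] by blast
    then obtain \<eta> where \<eta>: "\<eta> \<in> M" "opair (h \<gamma>) (opair (i \<kappa>) (opair (h \<beta>) \<eta>)) \<in> elts (j G)"
      and \<eta>_iff: "\<And>z. z \<in> M \<Longrightarrow> z \<in> elts \<eta> \<longleftrightarrow>
        (\<exists>\<beta>'\<in>elts (h \<beta>). \<exists>\<nu>\<in>elts (i \<kappa>). opair (h \<gamma>) (opair \<beta>' \<nu>) \<in> elts (j E) \<and>
          opair (h \<gamma>) (opair (i \<kappa>) (opair \<beta>' z)) \<in> elts (j G))"
      using jG_rec[rule_format, OF h\<gamma> i\<kappa>_j H.in_N[OF \<beta>_N]] by blast
    have "\<eta> = \<beta>"
    proof (rule elts_eqI, rule iffI)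
      fix z assume z: "z \<in> elts \<eta>"
      then have z_M: "z \<in> M"
        using \<eta>(1) J.elts_N by blast
      obtain \<beta>' \<nu> where \<beta>': "\<beta>' \<in> elts (h \<beta>)" "\<nu> \<in> elts (i \<kappa>)"
          "opair (h \<gamma>) (opair \<beta>' \<nu>) \<in> elts (j E)"
          "opair (h \<gamma>) (opair (i \<kappa>) (opair \<beta>' z)) \<in> elts (j G)"
        using z \<eta>_iff[OF z_M] by blast
      have \<nu>: "h \<nu> = \<nu>" "\<nu> \<in> N"
        using \<beta>'(2) h_fixed I.elts_N i_N by blast+
      \<comment> \<open>Since \<open>h\<close> fixes \<open>\<nu>\<close>, the existence of an
        argument with value \<open>\<nu>\<close> reflects from \<open>h \<beta>\<close> to
        \<open>\<beta>\<close>. Injectivity of \<open>j E\<close> at \<open>h \<gamma>\<close> then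
        shows that \<open>\<beta>'\<close> is \<open>h \<beta>''\<close>, where the induction
        hypothesis applies.\<close>
      have "\<exists>\<beta>''\<in>elts \<beta>. opair \<gamma> (opair \<beta>'' \<nu>) \<in> elts (i E)"
        by (rule iffD2[OF H.preserves4[where
                Q = "\<lambda>M b c n E. \<exists>x\<in>elts b. opair c (opair x n) \<in> elts E"]])
          (intro dfn, use \<beta>' \<nu> \<beta>_N \<gamma>_N hi in auto)
      then obtain \<beta>'' where \<beta>'': "\<beta>'' \<in> elts \<beta>" "opair \<gamma> (opair \<beta>'' \<nu>) \<in> elts (i E)" by blast
      have \<beta>''_N: "\<beta>'' \<in> N"
        using \<beta>''(1) \<beta>_N I.elts_N by blast
      have "opair (h \<gamma>) (opair (h \<beta>'') \<nu>) \<in> elts (j E)"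
        using H.embed_opair3[OF \<gamma>_N \<beta>''_N \<nu>(2) i_N[of E]] \<beta>''(2) \<nu>(1) by (simp add: hi)
      then have "\<beta>' = h \<beta>''"
        using jE_inj \<beta>'(1,3) \<beta>_N \<beta>''_N \<gamma>_N \<nu> H.elts_N H.in_N by metis
      moreover have "opair (h \<gamma>) (opair (i \<kappa>) (opair (h \<beta>'') \<beta>'')) \<in> elts (j G)"
        using step.IH[OF \<beta>''(1)] below[OF \<beta>''(1)] by blast
      moreover have "i \<kappa> \<in> M" "\<beta>'' \<in> M"
        using Ord_M[OF Ord_i\<kappa>] Ord_M[OF Ord_in_Ord[OF Ord_\<beta> \<beta>''(1)]] by blast+
      ultimately have "z = \<beta>''"
        using jG_fun \<beta>'(4) z_M H.in_N[OF \<gamma>_N] H.in_N[OF \<beta>''_N] by blast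
      with \<beta>'' show "z \<in> elts \<beta>" by simp
    next
      fix z assume z: "z \<in> elts \<beta>"
      have z_N: "z \<in> N"
        using z \<beta>_N I.elts_N by blast
      have z_M: "z \<in> M"
        using Ord_M[OF Ord_in_Ord[OF Ord_\<beta> z]] .
      \<comment> \<open>Conversely, the value of \<open>i E\<close> at \<open>z\<close> is below
        \<open>i \<kappa>\<close> and so fixed by \<open>h\<close>; hence \<open>h z\<close>
        contributes to the recursion for \<open>\<eta>\<close>.\<close>
      obtain \<nu> where \<nu>: "\<nu> \<in> elts (i \<kappa>)" "opair \<gamma> (opair z \<nu>) \<in> elts (i E)"
        using iE_total \<gamma> below[OF z] by blast
      have "\<nu> \<in> N"
        using \<nu>(1) I.elts_N i_N by blast
      then have "opair (h \<gamma>) (opair (h z) \<nu>) \<in> elts (j E)"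
        using H.embed_opair3[OF \<gamma>_N z_N _ i_N[of E], of \<nu>] \<nu> h_fixed[OF \<nu>(1)] by (simp add: hi)
      moreover have "h z \<in> elts (h \<beta>)"
        using H.embed_mem[OF z_N \<beta>_N] z by simp
      moreover have "opair (h \<gamma>) (opair (i \<kappa>) (opair (h z) z)) \<in> elts (j G)"
        using step.IH[OF z] below[OF z] by blast
      ultimately show "z \<in> elts \<eta>"
        using \<eta>_iff[OF z_M] \<nu>(1) by blast
    qed
    with \<eta>(2) show ?case by simp
  qed

  \<comment> \<open>The bounded covering set and its code\<close>
  \<comment> \<open>\<open>\<theta>\<close> bounds the transferred functions at
    \<open>i \<kappa>\<close>. By \<open>canonical\<close> every \<open>\<gamma>\<close> in
    \<open>i l\<close> is such a value, so \<open>i l\<close> lies below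
    \<open>\<theta>\<close>.\<close>
  obtain \<theta> where \<theta>: "\<theta> \<in> elts (j \<kappa>)"
    and \<theta>_bound: "\<forall>\<alpha>\<in>elts (j l). \<forall>\<eta>\<in>M. opair \<alpha> (opair (i \<kappa>) (opair \<alpha> \<eta>)) \<in> elts (j G) \<longrightarrow> \<eta> \<in> elts \<theta>"
    using jG_bound i\<kappa>_j by blast
  have il_N: "\<gamma> \<in> N" and il_M: "\<gamma> \<in> M" and il_h: "h \<gamma> \<in> elts (j l)" and il_\<theta>: "\<gamma> \<in> elts \<theta>"
    if "\<gamma> \<in> elts (i l)" for \<gamma>
  proof -
    show \<gamma>_N: "\<gamma> \<in> N"
      using that I.elts_N i_N by blast
    show \<gamma>_M: "\<gamma> \<in> M"
      using that Ord_M Ord_in_Ord[OF Ord_il] by blast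
    show "h \<gamma> \<in> elts (j l)"
      using H.embed_mem[OF \<gamma>_N i_N[of l]] that by (simp add: hi)
    then show "\<gamma> \<in> elts \<theta>"
      using \<theta>_bound \<gamma>_M canonical[OF that] by blast
  qed
  \<comment> \<open>Closure of \<open>M\<close> under binary intersection, to cut \<open>A\<close>
    down to \<open>\<theta>\<close>: only pairs bounded below \<open>j \<kappa>\<close> are sure to
    have a code.\<close>
  have "\<forall>a\<in>M. \<forall>b\<in>M. \<exists>c\<in>M. \<forall>x\<in>M. x \<in> elts c \<longleftrightarrow> x \<in> elts a \<and> x \<in> elts b"
  proof (rule iffD1[OF J.preserves1[where a = \<kappa> and
          Q = "\<lambda>M x. \<forall>a\<in>M. \<forall>b\<in>M. \<exists>c\<in>M. \<forall>x\<in>M. x \<in> elts c \<longleftrightarrow> x \<in> elts a \<and> x \<in> elts b"]])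
    have "x \<in> elts (vset (elts a \<inter> elts b)) \<longleftrightarrow> x \<in> elts a \<and> x \<in> elts b" for x a b :: 'a
      using small_subset[OF small_elts, of "elts a \<inter> elts b" a] by simp
    then show "\<forall>a\<in>UNIV. \<forall>b\<in>UNIV. \<exists>c\<in>UNIV. \<forall>x\<in>UNIV. x \<in> elts c \<longleftrightarrow> x \<in> elts a \<and> x \<in> elts (b::'a)"
      by blast
  qed (intro dfn, simp)
  moreover have \<theta>_M: "\<theta> \<in> M"
    using \<theta> J.elts_N j_M by blast
  ultimately obtain A' where A'_M: "A' \<in> M" and "\<forall>x\<in>M. x \<in> elts A' \<longleftrightarrow> x \<in> elts A \<and> x \<in> elts \<theta>"
    using A(1) by blast
  then have A': "x \<in> elts A' \<longleftrightarrow> x \<in> elts A \<and> x \<in> elts \<theta>" for x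
    using A(1) J.elts_N by blast
  have i\<kappa>_il: "i \<kappa> \<in> elts (i l)"
    using I.embed_mem[of \<kappa> l] \<kappa>_l by simp
  then have i\<kappa>_M: "i \<kappa> \<in> M"
    by (rule il_M)
  \<comment> \<open>The common bound is \<open>\<theta>\<close>: it contains
    \<open>i \<kappa>\<close>, a member of \<open>i l\<close>, and it includes
    \<open>A'\<close>.\<close>
  have "\<exists>\<zeta>\<in>elts (j \<kappa>). opair \<zeta> (opair (i \<kappa>) A') \<in> elts (j C)"
    using jC_total[rule_format, OF i\<kappa>_M A'_M] \<theta> il_\<theta>[OF i\<kappa>_il] A' by blast
  then obtain s where s: "s \<in> elts (j \<kappa>)" "opair s (opair (i \<kappa>) A') \<in> elts (j C)"
    by blast
  have s_M: "s \<in> M"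
    using s(1) J.elts_N j_M by blast
  have s_unique: "\<xi> = i \<kappa> \<and> a = A'" if "\<xi> \<in> M" "a \<in> M" "opair s (opair \<xi> a) \<in> elts (j C)" for \<xi> a
    using jC_inj that s_M s(2) i\<kappa>_M A'_M by blast
  \<comment> \<open>A code \<open>s\<close> below \<open>\<kappa>\<close> would be fixed by
    \<open>j\<close>, so the pair it codes would have first component \<open>j \<xi> = \<xi>\<close>
    with \<open>\<xi>\<close> below \<open>\<kappa>\<close>; but \<open>i \<kappa>\<close> is not in
    \<open>\<kappa>\<close>. This makes the derived ultrafilter nonprincipal.\<close>
  have s_\<kappa>: "s \<notin> elts \<kappa>"
  proof
    assume "s \<in> elts \<kappa>"
    then have js: "j s = s"
      by (rule j_fixed)
    have "\<exists>\<xi>\<in>elts \<kappa>. \<exists>a\<in>UNIV. opair s (opair \<xi> a) \<in> elts C"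
      by (rule iffD2[OF J.preserves3[where
              Q = "\<lambda>M k s C. \<exists>\<xi>\<in>elts k. \<exists>a\<in>M. opair s (opair \<xi> a) \<in> elts C"]])
        (intro dfn, simp, simp, simp, use s(2) js i\<kappa>_j A'_M in auto)
    then obtain \<xi> a where \<xi>: "\<xi> \<in> elts \<kappa>" "opair s (opair \<xi> a) \<in> elts C"
      by blast
    then have "opair s (opair (j \<xi>) (j a)) \<in> elts (j C)"
      using J.embed_opair3[of s \<xi> a C] js by simp
    then have "j \<xi> = i \<kappa>"
      using s_unique[OF j_M j_M] by blast
    with \<xi>(1) j_fixed i\<kappa>_not show False by simp
  qed

  \<comment> \<open>The ultrafilter derived from \<open>j\<close> and \<open>s\<close>\<close>
  define U where "U = vset {X. elts X \<subseteq> elts \<kappa> \<and> s \<in> elts (j X)}"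
  have "small {X. elts X \<subseteq> elts \<kappa> \<and> s \<in> elts (j X)}"
    by (rule small_subset[OF small_Pow[of \<kappa>]]) blast
  then have U: "X \<in> elts U \<longleftrightarrow> elts X \<subseteq> elts \<kappa> \<and> s \<in> elts (j X)" for X
    unfolding U_def by simp
  have elts_Int: "elts (vset (elts X \<inter> Y)) = elts X \<inter> Y" for X :: 'a and Y
    by (rule elts_vset, rule small_subset[OF small_elts]) blast
  have elts_Diff: "elts (vset (elts X - Y)) = elts X - Y" for X :: 'a and Y
    by (rule elts_vset, rule small_subset[OF small_elts]) blast
  have elts_inter: "elts (inter_over \<kappa> F) = {x \<in> elts \<kappa>. \<forall>X\<in>F. x \<in> elts X}" for F
    unfolding inter_over_def by (rule elts_vset, rule small_subset[OF small_elts[of \<kappa>]]) blast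
  have ultra: "ultrafilter_over \<kappa> U"
    unfolding ultrafilter_over_def
  proof (intro conjI ballI allI impI)
    show "vset {} \<notin> elts U"
    proof
      assume "vset {} \<in> elts U"
      moreover have "\<not> (\<exists>x\<in>elts (j (vset {})). x = x)"
        by (rule iffD1[OF J.preserves1[where Q = "\<lambda>M e. \<not> (\<exists>x\<in>elts e. x = x)"]])
          (intro dfn, simp_all)
      ultimately show False
        unfolding U by blast
    qed
  next
    fix X Y assume X: "X \<in> elts U" "elts X \<subseteq> elts Y" "elts Y \<subseteq> elts \<kappa>"
    have "elts (j X) \<subseteq> elts (j Y)"
      by (rule iffD1[OF J.preserves2[where Q = "\<lambda>M a b. elts a \<subseteq> elts b"]]) (intro dfn, use X in simp_all)
    then show "Y \<in> elts U"
      using X unfolding U by blast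
  next
    fix X Y assume X: "X \<in> elts U" "Y \<in> elts U"
    let ?Z = "vset (elts X \<inter> elts Y)"
    have "\<forall>x\<in>elts (j X). x \<in> elts (j Y) \<longrightarrow> x \<in> elts (j ?Z)"
      by (rule iffD1[OF J.preserves3[where Q = "\<lambda>M a b c. \<forall>x\<in>elts a. x \<in> elts b \<longrightarrow> x \<in> elts c"]])
        (intro dfn, simp_all add: elts_Int)
    then show "?Z \<in> elts U"
      using X unfolding U elts_Int by blast
  next
    fix X :: 'a assume X: "elts X \<subseteq> elts \<kappa>"
    let ?Z = "vset (elts \<kappa> - elts X)"
    have "\<forall>x\<in>elts (j \<kappa>). x \<in> elts (j X) \<or> x \<in> elts (j ?Z)"
      by (rule iffD1[OF J.preserves3[where Q = "\<lambda>M a b c. \<forall>x\<in>elts a. x \<in> elts b \<or> x \<in> elts c"]])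
        (intro dfn, simp_all add: elts_Diff)
    then show "X \<in> elts U \<or> ?Z \<in> elts U"
      using X s(1) unfolding U elts_Diff by blast
  qed (use U s(1) in auto)
  have nonprincipal: "vset {a} \<notin> elts U" if "a \<in> elts \<kappa>" for a
  proof
    assume "vset {a} \<in> elts U"
    moreover have "\<forall>x\<in>elts (j (vset {a})). x = j a"
      by (rule iffD1[OF J.preserves2[where Q = "\<lambda>M e a. \<forall>x\<in>elts e. x = a"]]) (intro dfn, simp_all)
    ultimately have "s = j a"
      unfolding U by blast
    with that s_\<kappa> j_fixed show False by simp
  qed
  have complete: "inter_over \<kappa> (elts F) \<in> elts U" if F: "elts F \<subseteq> elts U" "vcard F \<^bold>\<in> \<kappa>" for F
  proof -
    let ?Z = "inter_over \<kappa> (elts F)"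
    obtain f where "is_bijection f F (vcard F)"
      using vcard(2) by blast
    then have jf: "is_bijection (j f) (j F) (vcard F)"
      using J.preserves3[where Q = "\<lambda>M f a b. is_bijection f a b", of f F "vcard F"] F(2) j_fixed
      by (auto simp: mem_iff intro: dfn)
    \<comment> \<open>\<open>F\<close> is indexed by fewer than \<open>\<kappa>\<close> ordinals,
      all fixed by \<open>j\<close>; so \<open>j F\<close> has no members beyond the images
      \<open>j Y\<close> of members \<open>Y\<close> of \<open>F\<close>.\<close>
    have "s \<in> elts X" if X: "X \<in> elts (j F)" for X
    proof -
      obtain \<nu> where \<nu>: "\<nu> \<in> elts (vcard F)" "opair X \<nu> \<in> elts (j f)"
        using jf X unfolding is_bijection_alt by blast
      have "\<nu> \<in> elts \<kappa>"
        using \<nu>(1) F(2) Ord_trans[OF Ord_\<kappa>] unfolding mem_iff by blast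
      then have j\<nu>: "j \<nu> = \<nu>"
        by (rule j_fixed)
      have "\<exists>X\<in>elts F. opair X \<nu> \<in> elts f"
        by (rule iffD2[OF J.preserves3[where Q = "\<lambda>M a b f. \<exists>X\<in>elts a. opair X b \<in> elts f"]])
          (intro dfn, simp, simp, simp, use X \<nu> j\<nu> in auto)
      then obtain Y where Y: "Y \<in> elts F" "opair Y \<nu> \<in> elts f"
        by blast
      then have "opair (j Y) \<nu> \<in> elts (j f)" "j Y \<in> elts (j F)"
        using J.embed_opair[of Y \<nu> f] J.embed_mem[of Y F] j\<nu> by simp_all
      then have "X = j Y"
        using jf X \<nu> unfolding is_bijection_alt by blast
      then show ?thesis
        using Y(1) F(1) U by blast
    qed
    moreover have "\<forall>x\<in>elts (j \<kappa>). (\<forall>X\<in>elts (j F). x \<in> elts X) \<longrightarrow> x \<in> elts (j ?Z)"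
      by (rule iffD1[OF J.preserves3[where
              Q = "\<lambda>M k F Z. \<forall>x\<in>elts k. (\<forall>X\<in>elts F. x \<in> elts X) \<longrightarrow> x \<in> elts Z"]])
        (intro dfn, simp_all add: elts_inter)
    ultimately show ?thesis
      unfolding U using s(1) elts_inter by auto
  qed

  \<comment> \<open>Failure of the Galvin property\<close>
  have "\<not> Gal \<kappa> U \<kappa> l"
  proof
    assume gal: "Gal \<kappa> U \<kappa> l"
    \<comment> \<open>Ordinals below \<open>\<kappa>\<close> that code no pair also belong,
      vacuously. This does no harm, as \<open>s\<close> codes exactly the pair of
      \<open>i \<kappa>\<close> and \<open>A'\<close>.\<close>
    define A\<^sub>0 where "A\<^sub>0 \<alpha> = vset (elts \<kappa> \<inter> {\<zeta>. \<forall>\<xi> a \<eta>. opair \<zeta> (opair \<xi> a) \<in> elts C \<longrightarrow>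
        opair \<alpha> (opair \<xi> (opair \<alpha> \<eta>)) \<in> elts G \<longrightarrow> \<eta> \<in> elts a})" for \<alpha>
    have A\<^sub>0: "\<zeta> \<in> elts (A\<^sub>0 \<alpha>) \<longleftrightarrow> \<zeta> \<in> elts \<kappa> \<and> (\<forall>\<xi> a \<eta>. opair \<zeta> (opair \<xi> a) \<in> elts C \<longrightarrow>
        opair \<alpha> (opair \<xi> (opair \<alpha> \<eta>)) \<in> elts G \<longrightarrow> \<eta> \<in> elts a)" for \<alpha> \<zeta>
      unfolding A\<^sub>0_def elts_Int by blast
    have "A\<^sub>0 \<alpha> \<in> elts U" if \<alpha>: "\<alpha> \<in> elts l" for \<alpha>
    proof -
      have "\<forall>\<zeta>\<in>elts (j \<kappa>). (\<forall>\<xi>\<in>M. \<forall>a\<in>M. \<forall>\<eta>\<in>M. opair \<zeta> (opair \<xi> a) \<in> elts (j C) \<longrightarrow>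
          opair (j \<alpha>) (opair \<xi> (opair (j \<alpha>) \<eta>)) \<in> elts (j G) \<longrightarrow> \<eta> \<in> elts a) \<longrightarrow> \<zeta> \<in> elts (j (A\<^sub>0 \<alpha>))"
        by (rule iffD1[OF J.preserves5[where Q = "\<lambda>M k C G \<alpha> X.
                \<forall>\<zeta>\<in>elts k. (\<forall>\<xi>\<in>M. \<forall>a\<in>M. \<forall>\<eta>\<in>M. opair \<zeta> (opair \<xi> a) \<in> elts C \<longrightarrow>
                  opair \<alpha> (opair \<xi> (opair \<alpha> \<eta>)) \<in> elts G \<longrightarrow> \<eta> \<in> elts a) \<longrightarrow> \<zeta> \<in> elts X"]])
          (intro dfn, simp_all add: A\<^sub>0)
      moreover have "\<eta> \<in> elts a"
        if a: "\<xi> \<in> M" "a \<in> M" "\<eta> \<in> M" "opair s (opair \<xi> a) \<in> elts (j C)"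
          and \<eta>: "opair (j \<alpha>) (opair \<xi> (opair (j \<alpha>) \<eta>)) \<in> elts (j G)" for \<xi> a \<eta>
      proof -
        have "\<xi> = i \<kappa>" "a = A'"
          using s_unique[OF a(1,2,4)] by auto
        have i\<alpha>: "i \<alpha> \<in> elts (i l)"
          using I.embed_mem[of \<alpha> l] \<alpha> by simp
        \<comment> \<open>As \<open>j \<alpha> = h (i \<alpha>)\<close>, the canonical value here is
          \<open>i \<alpha>\<close>, which lies in both \<open>A\<close> and
          \<open>\<theta>\<close>.\<close>
        have "opair (j \<alpha>) (opair (i \<kappa>) (opair (j \<alpha>) (i \<alpha>))) \<in> elts (j G)"
          using canonical[OF i\<alpha>, of "i \<alpha>"] by (simp add: hi)
        then have "\<eta> = i \<alpha>"
          using jG_fun \<eta> a(3) i\<kappa>_M j_M il_M[OF i\<alpha>] unfolding \<open>\<xi> = i \<kappa>\<close> by blast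
        then show ?thesis
          using A(2) \<alpha> il_\<theta>[OF i\<alpha>] unfolding \<open>a = A'\<close> A' by blast
      qed
      ultimately show ?thesis
        unfolding U using s(1) A\<^sub>0 by blast
    qed
    then obtain I\<^sub>0 where I\<^sub>0: "elts I\<^sub>0 \<subseteq> elts l" "vcard I\<^sub>0 = \<kappa>" "inter_over \<kappa> (A\<^sub>0 ` elts I\<^sub>0) \<in> elts U"
      using gal[unfolded Gal_def, rule_format, of A\<^sub>0] by blast
    let ?Z = "inter_over \<kappa> (A\<^sub>0 ` elts I\<^sub>0)"
    have Z: "\<eta> \<in> elts a" if "\<zeta> \<in> elts ?Z" "\<alpha> \<in> elts I\<^sub>0" "opair \<zeta> (opair \<xi> a) \<in> elts C"
      "opair \<alpha> (opair \<xi> (opair \<alpha> \<eta>)) \<in> elts G" for \<zeta> \<alpha> \<xi> a \<eta>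
    proof -
      have "\<zeta> \<in> elts (A\<^sub>0 \<alpha>)"
        using that(1,2) unfolding elts_inter by blast
      then show ?thesis
        using that(3,4) unfolding A\<^sub>0 by blast
    qed
    \<comment> \<open>The gain over the single sets is that \<open>\<alpha>\<close> now runs through
      all of \<open>j I\<^sub>0\<close>, including \<open>h \<gamma>\<close> for every
      \<open>\<gamma>\<close> in \<open>i I\<^sub>0\<close>; at \<open>h \<gamma>\<close> the
      canonical value is \<open>\<gamma>\<close>.\<close>
    have "\<forall>\<zeta>\<in>elts (j ?Z). \<forall>\<alpha>\<in>elts (j I\<^sub>0). \<forall>\<xi>\<in>M. \<forall>a\<in>M. \<forall>\<eta>\<in>M. opair \<zeta> (opair \<xi> a) \<in> elts (j C) \<longrightarrow>
          opair \<alpha> (opair \<xi> (opair \<alpha> \<eta>)) \<in> elts (j G) \<longrightarrow> \<eta> \<in> elts a"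
      by (rule iffD1[OF J.preserves4[where Q = "\<lambda>M Z I C G.
              \<forall>\<zeta>\<in>elts Z. \<forall>\<alpha>\<in>elts I. \<forall>\<xi>\<in>M. \<forall>a\<in>M. \<forall>\<eta>\<in>M. opair \<zeta> (opair \<xi> a) \<in> elts C \<longrightarrow>
                opair \<alpha> (opair \<xi> (opair \<alpha> \<eta>)) \<in> elts G \<longrightarrow> \<eta> \<in> elts a"]])
        (intro dfn, simp, simp, simp, simp, intro ballI impI, rule Z)
    moreover have "s \<in> elts (j ?Z)"
      using I\<^sub>0(3) unfolding U by blast
    ultimately have in_A': "\<eta> \<in> elts A'" if "\<alpha> \<in> elts (j I\<^sub>0)" "\<eta> \<in> M"
      "opair \<alpha> (opair (i \<kappa>) (opair \<alpha> \<eta>)) \<in> elts (j G)" for \<alpha> \<eta>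
      using that s(2) i\<kappa>_M A'_M by blast
    obtain f where f: "is_bijection f I\<^sub>0 \<kappa>"
      using vcard(2)[of I\<^sub>0] I\<^sub>0(2) by auto
    have jf: "is_bijection (j f) (j I\<^sub>0) (j \<kappa>)"
      by (rule iffD1[OF J.preserves3[where Q = "\<lambda>M f a b. is_bijection f a b"]])
        (intro dfn, simp_all add: f)
    have if': "is_bijection (i f) (i I\<^sub>0) (i \<kappa>)"
      by (rule iffD1[OF I.preserves3[where Q = "\<lambda>M f a b. is_bijection f a b"]])
        (intro dfn, simp_all add: f)
    have iI_l: "elts (i I\<^sub>0) \<subseteq> elts (i l)"
      by (rule iffD1[OF I.preserves2[where Q = "\<lambda>M a b. elts a \<subseteq> elts b"]])
        (intro dfn, simp_all add: I\<^sub>0)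
    have iI_A': "\<gamma> \<in> elts A'" if \<gamma>: "\<gamma> \<in> elts (i I\<^sub>0)" for \<gamma>
    proof -
      have \<gamma>_l: "\<gamma> \<in> elts (i l)"
        using iI_l \<gamma> by blast
      have "h \<gamma> \<in> elts (j I\<^sub>0)"
        using H.embed_mem[OF il_N[OF \<gamma>_l] i_N[of I\<^sub>0]] \<gamma> by (simp add: hi)
      then show ?thesis
        using in_A' il_M[OF \<gamma>_l] canonical[OF \<gamma>_l] by blast
    qed

    \<comment> \<open>An injection of \<open>i \<kappa>\<close> into \<open>\<delta>\<close> inside
      \<open>M\<close>\<close>
    have preimage: "\<exists>\<gamma>\<in>elts (i I\<^sub>0). opair \<gamma> \<nu> \<in> elts (i f) \<and> h \<gamma> \<in> elts (j I\<^sub>0) \<and>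
        opair (h \<gamma>) \<nu> \<in> elts (j f) \<and> opair (h \<gamma>) (opair (i \<kappa>) (opair (h \<gamma>) \<gamma>)) \<in> elts (j G)"
      if \<nu>: "\<nu> \<in> elts (i \<kappa>)" for \<nu>
    proof -
      obtain \<gamma> where \<gamma>: "\<gamma> \<in> elts (i I\<^sub>0)" "opair \<gamma> \<nu> \<in> elts (i f)"
        using if' \<nu> unfolding is_bijection_alt by blast
      have \<gamma>_l: "\<gamma> \<in> elts (i l)"
        using iI_l \<gamma>(1) by blast
      have "\<nu> \<in> N"
        using \<nu> I.elts_N i_N by blast
      \<comment> \<open>\<open>h\<close> maps \<open>i f\<close> to \<open>j f\<close> and fixes
        \<open>\<nu>\<close>, so it carries the preimage of \<open>\<nu>\<close> under the former to
        that under the latter.\<close>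
      then have "opair (h \<gamma>) \<nu> \<in> elts (j f)"
        using H.embed_opair[OF il_N[OF \<gamma>_l] _ i_N[of f], of \<nu>] \<gamma>(2) h_fixed[OF \<nu>] by (simp add: hi)
      moreover have "h \<gamma> \<in> elts (j I\<^sub>0)"
        using H.embed_mem[OF il_N[OF \<gamma>_l] i_N[of I\<^sub>0]] \<gamma>(1) by (simp add: hi)
      ultimately show ?thesis
        using \<gamma> canonical[OF \<gamma>_l] by blast
    qed
    have i\<kappa>_sub: "elts (i \<kappa>) \<subseteq> elts (j \<kappa>)"
      using Ord_trans[OF Ord_j\<kappa> i\<kappa>_j] by blast

    \<comment> \<open>\<open>i f\<close> is not known to lie in \<open>M\<close>, so the injection
      is composed from \<open>j f\<close>, \<open>j G\<close> and \<open>B\<close>: from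
      \<open>\<nu>\<close> to its preimage in \<open>j I\<^sub>0\<close>, then to the canonical
      value at \<open>i \<kappa>\<close>, then into \<open>\<delta>\<close>. The existence of such
      composites is transferred from the universe.\<close>
    have composition: "\<forall>f\<in>M. \<forall>G\<in>M. \<forall>B\<in>M. \<forall>k\<in>M. \<forall>d\<in>M. \<forall>I\<in>M. \<forall>x\<in>M. \<exists>r\<in>M. \<forall>n\<in>elts k. \<forall>y\<in>elts d.
        opair n y \<in> elts r \<longleftrightarrow> (\<exists>a\<in>elts I. \<exists>z\<in>M. opair a n \<in> elts f \<and>
          opair a (opair x (opair a z)) \<in> elts G \<and> opair z y \<in> elts B)"
    proof (rule iffD1[OF J.preserves1[where a = \<kappa> and Q = "\<lambda>M w. \<forall>f\<in>M. \<forall>G\<in>M. \<forall>B\<in>M. \<forall>k\<in>M. \<forall>d\<in>M.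
              \<forall>I\<in>M. \<forall>x\<in>M. \<exists>r\<in>M. \<forall>n\<in>elts k. \<forall>y\<in>elts d.
                opair n y \<in> elts r \<longleftrightarrow> (\<exists>a\<in>elts I. \<exists>z\<in>M. opair a n \<in> elts f \<and>
                  opair a (opair x (opair a z)) \<in> elts G \<and> opair z y \<in> elts B)"]])
      have "\<exists>r. \<forall>n\<in>elts k. \<forall>y\<in>elts d. opair n y \<in> elts r \<longleftrightarrow> P n y" for k d :: 'a and P
        using set_relation2[of k d P] by metis
      then show "\<forall>f\<in>UNIV. \<forall>G\<in>UNIV. \<forall>B\<in>UNIV. \<forall>k\<in>UNIV. \<forall>d\<in>UNIV.
              \<forall>I\<in>UNIV. \<forall>x\<in>UNIV. \<exists>r\<in>UNIV. \<forall>n\<in>elts k. \<forall>y\<in>elts d.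
                opair n y \<in> elts r \<longleftrightarrow> (\<exists>a\<in>elts I. \<exists>z\<in>UNIV. opair a n \<in> elts f \<and>
                  opair a (opair x (opair a z)) \<in> elts G \<and> opair z y \<in> elts (B::'a))"
        by (intro ballI) simp
    qed (intro dfn, simp)
    obtain r where r_M: "r \<in> M" and r: "\<And>\<nu> y. \<nu> \<in> elts (i \<kappa>) \<Longrightarrow> y \<in> elts \<delta> \<Longrightarrow>
        opair \<nu> y \<in> elts r \<longleftrightarrow> (\<exists>\<alpha>\<in>elts (j I\<^sub>0). \<exists>\<eta>\<in>M. opair \<alpha> \<nu> \<in> elts (j f) \<and>
          opair \<alpha> (opair (i \<kappa>) (opair \<alpha> \<eta>)) \<in> elts (j G) \<and> opair \<eta> y \<in> elts B)"
      using composition[rule_format, OF j_M[of f] j_M[of G] B(1) i\<kappa>_M \<delta>_M j_M[of I\<^sub>0] i\<kappa>_M] by blast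
    \<comment> \<open>Reads \<open>r\<close> backwards: uniqueness of preimages under
      \<open>j f\<close> forces \<open>\<alpha> = h \<gamma>\<close>, and single-valuedness of
      \<open>j G\<close> forces \<open>\<eta> = \<gamma>\<close>.\<close>
    have r_via: "\<exists>\<gamma>\<in>elts (i I\<^sub>0). opair \<gamma> \<nu> \<in> elts (i f) \<and> opair \<gamma> y \<in> elts B"
      if \<nu>: "\<nu> \<in> elts (i \<kappa>)" and y: "y \<in> elts \<delta>" and \<nu>y: "opair \<nu> y \<in> elts r" for \<nu> y
    proof -
      obtain \<alpha> \<eta> where \<alpha>: "\<alpha> \<in> elts (j I\<^sub>0)" "\<eta> \<in> M" "opair \<alpha> \<nu> \<in> elts (j f)"
          "opair \<alpha> (opair (i \<kappa>) (opair \<alpha> \<eta>)) \<in> elts (j G)" "opair \<eta> y \<in> elts B"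
        using r[OF \<nu> y] \<nu>y by blast
      obtain \<gamma> where \<gamma>: "\<gamma> \<in> elts (i I\<^sub>0)" "opair \<gamma> \<nu> \<in> elts (i f)" "h \<gamma> \<in> elts (j I\<^sub>0)"
          "opair (h \<gamma>) \<nu> \<in> elts (j f)" "opair (h \<gamma>) (opair (i \<kappa>) (opair (h \<gamma>) \<gamma>)) \<in> elts (j G)"
        using preimage[OF \<nu>] by blast
      have "\<alpha> = h \<gamma>"
        using jf \<alpha>(1,3) \<gamma>(3,4) i\<kappa>_sub \<nu> unfolding is_bijection_alt by blast
      then have "\<eta> = \<gamma>"
        using jG_fun \<alpha>(2,4) \<gamma>(5) i\<kappa>_M il_M[of \<gamma>] iI_l \<gamma>(1) J.elts_N[OF \<gamma>(3) j_M] by blast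
      with \<gamma> \<alpha>(5) show ?thesis by blast
    qed
    have "injects r (i \<kappa>) \<delta>"
      unfolding injects_def
    proof (intro conjI ballI impI)
      fix \<nu> assume \<nu>: "\<nu> \<in> elts (i \<kappa>)"
      obtain \<gamma> where \<gamma>: "\<gamma> \<in> elts (i I\<^sub>0)" "h \<gamma> \<in> elts (j I\<^sub>0)"
          "opair (h \<gamma>) \<nu> \<in> elts (j f)" "opair (h \<gamma>) (opair (i \<kappa>) (opair (h \<gamma>) \<gamma>)) \<in> elts (j G)"
        using preimage[OF \<nu>] by blast
      obtain y where y: "y \<in> elts \<delta>" "opair \<gamma> y \<in> elts B"
        using B(2) iI_A'[OF \<gamma>(1)] unfolding is_bijection_alt A' by blast
      have "\<gamma> \<in> M"
        using il_M iI_l \<gamma>(1) by blast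
      then have "opair \<nu> y \<in> elts r"
        using r[OF \<nu> y(1)] \<gamma> y(2) by blast
      with y(1) show "\<exists>y\<in>elts \<delta>. opair \<nu> y \<in> elts r" by blast
    next
      fix \<nu> \<nu>' y assume \<nu>: "\<nu> \<in> elts (i \<kappa>)" "\<nu>' \<in> elts (i \<kappa>)" and y: "y \<in> elts \<delta>"
        and "opair \<nu> y \<in> elts r" "opair \<nu>' y \<in> elts r"
      then obtain \<gamma> \<gamma>' where \<gamma>: "\<gamma> \<in> elts (i I\<^sub>0)" "opair \<gamma> \<nu> \<in> elts (i f)" "opair \<gamma> y \<in> elts B"
          and \<gamma>': "\<gamma>' \<in> elts (i I\<^sub>0)" "opair \<gamma>' \<nu>' \<in> elts (i f)" "opair \<gamma>' y \<in> elts B"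
        using r_via by blast
      have "\<gamma> \<in> elts A" "\<gamma>' \<in> elts A"
        using iI_A' \<gamma>(1) \<gamma>'(1) A' by blast+
      then have "\<gamma> = \<gamma>'"
        using B(2) y \<gamma>(3) \<gamma>'(3) unfolding is_bijection_alt by blast
      then show "\<nu> = \<nu>'"
        using if' \<nu> \<gamma>(1,2) \<gamma>'(2) unfolding is_bijection_alt by blast
    qed

    \<comment> \<open>The limit property of \<open>i \<kappa>\<close> excludes the injection\<close>
    moreover have "\<forall>d\<in>elts (i \<kappa>). \<exists>\<mu>\<in>elts (i \<kappa>). \<forall>r\<in>N. \<not> injects r \<mu> d"
      by (rule iffD1[OF I.preserves1[where
              Q = "\<lambda>M k. \<forall>d\<in>elts k. \<exists>\<mu>\<in>elts k. \<forall>r\<in>M. \<not> injects r \<mu> d"]])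
        (intro dfn, simp_all add: limit)
    then obtain \<mu> where \<mu>: "\<mu> \<in> elts (i \<kappa>)" "\<forall>r\<in>N. \<not> injects r \<mu> \<delta>"
      using \<delta> by blast
    have \<mu>_N: "\<mu> \<in> N"
      using \<mu>(1) I.elts_N i_N by blast
    \<comment> \<open>Applying \<open>h\<close> moves non-injectability from \<open>N\<close> to
      \<open>M\<close> with the same \<open>\<mu>\<close> and \<open>\<delta>\<close>, both fixed as
      they lie below \<open>i \<kappa>\<close>; but \<open>r\<close> also injects the subset
      \<open>\<mu>\<close> of \<open>i \<kappa>\<close>.\<close>
    have "\<forall>r\<in>M. \<not> injects r (h \<mu>) (h \<delta>)"
      by (rule iffD1[OF H.preserves2[where Q = "\<lambda>M m d. \<forall>r\<in>M. \<not> injects r m d"]])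
        (intro dfn, use \<mu>(2) \<mu>_N \<delta>_N in simp_all)
    then have "\<forall>r\<in>M. \<not> injects r \<mu> \<delta>"
      using h_fixed \<mu>(1) \<delta> by simp
    moreover have "elts \<mu> \<subseteq> elts (i \<kappa>)"
      using Ord_trans[OF Ord_i\<kappa> \<mu>(1)] by blast
    ultimately show False
      using r_M injects_subset by blast
  qed
  moreover have "complete_ultrafilter_over \<kappa> U"
    unfolding complete_ultrafilter_over_def using ultra nonprincipal complete by blast
  ultimately show ?thesis
    unfolding non_Galvin_ultrafilter_def l_def by metis
qed

end
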